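(* For any $\varepsilon\in(0,1)$ (which may depend on $n$), there is a randomized algorithm in the LOCAL model which, on any $n$-node graph $G=(V,E)$ with non-negative vertex weights $w_0:V\to\mathbb{R}_{\ge 0}$, runs in $O\!\left(\frac{\log n}{\log^2\log n}+\frac{\log n\,\log(1/\varepsilon)}{\log^3\log n}\right)$ rounds and, with probability at least $1-n^{-c}$ for some constant $c\ge 1$, outputs a vertex cover $S\subseteq V$ with $\sum_{v\in S}w_0(v)\le (2+\varepsilon)\,OPT$, where $OPT$ is the minimum total weight of a vertex cover of $G$. *)

theory Defs
  imports "HOL-Probability.Probability"
begin

definition graph :: "nat set \<Rightarrow> nat set set \<Rightarrow> bool" where
  "graph V E \<longleftrightarrow> finite V \<and> E \<subseteq> {{x, y} | x y. x \<in> V \<and> y \<in> V \<and> x \<noteq> y}"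

definition adjrel :: "nat set set \<Rightarrow> (nat \<times> nat) set" where
  "adjrel E = {(x, y). {x, y} \<in> E}"

definition ball_G :: "nat set set \<Rightarrow> nat \<Rightarrow> nat \<Rightarrow> nat set" where
  "ball_G E T v = {u. \<exists>k\<le>T. (v, u) \<in> (adjrel E) ^^ k}"

definition is_vertex_cover :: "nat set \<Rightarrow> nat set set \<Rightarrow> nat set \<Rightarrow> bool" where
  "is_vertex_cover V E S \<longleftrightarrow> S \<subseteq> V \<and> (\<forall>e\<in>E. e \<inter> S \<noteq> {})"

definition OPT_vc :: "nat set \<Rightarrow> nat set set \<Rightarrow> (nat \<Rightarrow> real) \<Rightarrow> real" where
  "OPT_vc V E w = Min {sum w S | S. is_vertex_cover V E S}"

definition valid_input :: "nat \<Rightarrow> nat set \<Rightarrow> nat set set \<Rightarrow> (nat \<Rightarrow> real) \<Rightarrow> bool" where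
  "valid_input n V E w \<longleftrightarrow> graph V E \<and> card V = n \<and> (\<forall>v\<in>V. w v \<ge> 0)"

text \<open>A (randomized) distributed algorithm: given the graph, the weights and the
  private random values of all nodes, node v decides whether it joins the output set.
  It is a T-round LOCAL algorithm if the decision of v depends only on the T-hop
  view of v: the vertices of its T-ball, the edges among them, and the inputs
  (weights, random values) of these vertices.\<close>
type_synonym dist_alg = "nat set \<Rightarrow> nat set set \<Rightarrow> (nat \<Rightarrow> real) \<Rightarrow> (nat \<Rightarrow> real) \<Rightarrow> nat \<Rightarrow> bool"

definition local_alg :: "nat \<Rightarrow> nat \<Rightarrow> dist_alg \<Rightarrow> bool" where
  "local_alg T n A \<longleftrightarrow>
     (\<forall>V E w \<rho> V' E' w' \<rho>' v.
        valid_input n V E w \<and> valid_input n V' E' w' \<and> v \<in> V \<and> v \<in> V' \<and>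
        ball_G E T v = ball_G E' T v \<and>
        (\<forall>u\<in>ball_G E T v. w u = w' u \<and> \<rho> u = \<rho>' u) \<and>
        (\<forall>x\<in>ball_G E T v. \<forall>y\<in>ball_G E T v. {x, y} \<in> E \<longleftrightarrow> {x, y} \<in> E')
        \<longrightarrow> A V E w \<rho> v = A V' E' w' \<rho>' v)"

text \<open>Private randomness: each node draws an independent uniform real in [0,1]
  (equivalent to an infinite sequence of independent fair bits).\<close>
definition rand_space :: "nat set \<Rightarrow> (nat \<Rightarrow> real) measure" where
  "rand_space V = PiM V (\<lambda>_. uniform_measure lborel {0..1::real})"

definition alg_output :: "dist_alg \<Rightarrow> nat set \<Rightarrow> nat set set \<Rightarrow> (nat \<Rightarrow> real) \<Rightarrow> (nat \<Rightarrow> real) \<Rightarrow> nat set" where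
  "alg_output A V E w \<rho> = {v \<in> V. A V E w \<rho> v}"

end

theory Submission
  imports Defs "HOL-Real_Asymp.Real_Asymp"
begin

text \<open>The algorithm is primal-dual: it grows a fractional matching and outputs the vertices whose
  weight is used up to a factor \<open>1 - \<epsilon>/4\<close>. The usual scheme offers a share of the residual weight
  to every incident edge and multiplies the shares that were used up; it takes about
  \<open>log \<Delta> / log log \<Delta>\<close> rounds. Here shares go to clusters of edges instead, which costs a factor
  (cluster radius) per iteration, but a vertex meets few clusters.

  In a ball of \<open>n\<close> vertices the growth factors over the radii \<open>1, \<dots>, R\<close> multiply to at most
  \<open>n\<close>, so every vertex has a scale \<open>i \<le> R\<close> at which its ball of radius about \<open>2i\<close> grows in two hops
  by at most \<open>n\<close> to the power \<open>1/(i H)\<close>, where \<open>H\<close> is the \<open>R\<close>-th harmonic number. Joining a randomly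
  marked center of that ball, a vertex of scale \<open>i\<close> is in a cluster of radius about \<open>2i\<close>, and
  with high probability every vertex meets few more than \<open>n\<close> to the power \<open>1/(i H)\<close> clusters of
  scale \<open>i\<close>. Scale \<open>i\<close> thus needs about \<open>log n / (i H log R)\<close> iterations of \<open>O(i)\<close> rounds each.
  Running all scales in parallel, with \<open>R\<close> a small power of \<open>log n\<close>, takes
  \<open>O(log n / (H log R))\<close> rounds, and \<open>H\<close> and \<open>log R\<close> are of order \<open>log log n\<close>.\<close>

section \<open>Growing a fractional matching by clusters\<close>

definition load :: "nat set set \<Rightarrow> (nat set \<Rightarrow> real) \<Rightarrow> nat \<Rightarrow> real" where
  "load F y u = (\<Sum>e | e \<in> F \<and> u \<in> e. y e)"

definition maximal_packing :: "nat set set \<Rightarrow> (nat \<Rightarrow> real) \<Rightarrow> (nat set \<Rightarrow> real) \<Rightarrow> bool" where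
  "maximal_packing F b y \<longleftrightarrow>
     (\<forall>e. 0 \<le> y e) \<and> (\<forall>u. load F y u \<le> b u) \<and> (\<forall>e\<in>F. \<exists>u\<in>e. load F y u = b u)"

text \<open>The choice is a function of \<open>F\<close> and \<open>b\<close> alone, so all vertices
  that know the edges and offers of a cluster evaluate the same packing.\<close>

definition packing :: "nat set set \<Rightarrow> (nat \<Rightarrow> real) \<Rightarrow> nat set \<Rightarrow> real" where
  "packing F b = (SOME y. maximal_packing F b y)"

text \<open>Greedy: a new edge is raised by the smallest remaining capacity of its vertices, which
  makes one of them tight. If the edge contains a vertex that was tight before, the increment is 0,
  so tight vertices stay tight.\<close>

lemma maximal_packing_exists:
  assumes "finite F" "\<And>e. e \<in> F \<Longrightarrow> finite e \<and> e \<noteq> {}" "\<And>u. 0 \<le> b u"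
  shows "\<exists>y. maximal_packing F b y"
  using assms(1,2)
proof (induction F rule: finite_induct)
  case empty
  then show ?case
    by (auto simp: maximal_packing_def load_def assms(3) intro!: exI[of _ "\<lambda>_. 0"])
next
  case (insert e F)
  then obtain y where y: "maximal_packing F b y" by auto
  define m where "m = Min ((\<lambda>u. b u - load F y u) ` e)"
  have e: "finite e" "e \<noteq> {}" using insert.prems by auto
  have m_le: "m \<le> b u - load F y u" if "u \<in> e" for u
    unfolding m_def using e that by simp
  have "m \<in> (\<lambda>u. b u - load F y u) ` e"
    unfolding m_def by (rule Min_in) (use e in auto)
  then obtain u0 where u0: "u0 \<in> e" "m = b u0 - load F y u0" by auto
  have m0: "0 \<le> m" using y u0 by (simp add: maximal_packing_def)
  \<comment> \<open>Overwriting \<open>y e\<close> is harmless: \<open>e\<close> is not in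
    \<open>F\<close>, so the old value enters no load of \<open>F\<close>.\<close>
  define z where "z = y(e := m)"
  have load_z: "load (insert e F) z u = load F y u + (if u \<in> e then m else 0)" for u
  proof -
    have "load F z u = load F y u"
      unfolding load_def z_def by (rule sum.cong) (use insert.hyps in auto)
    moreover have "load (insert e F) z u = (if u \<in> e then z e else 0) + load F z u"
    proof (cases "u \<in> e")
      case True
      then have "{e'. e' \<in> insert e F \<and> u \<in> e'} = insert e {e'. e' \<in> F \<and> u \<in> e'}" by auto
      then show ?thesis using True insert.hyps by (simp add: load_def)
    next
      case False
      then have "{e'. e' \<in> insert e F \<and> u \<in> e'} = {e'. e' \<in> F \<and> u \<in> e'}" by auto
      then show ?thesis using False by (simp add: load_def)
    qed
    ultimately show ?thesis by (simp add: z_def)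
  qed
  have "maximal_packing (insert e F) b z"
    unfolding maximal_packing_def
  proof (intro conjI allI ballI)
    fix e' show "0 \<le> z e'" using y m0 by (simp add: z_def maximal_packing_def)
  next
    fix u show "load (insert e F) z u \<le> b u"
      using m_le[of u] y by (auto simp: load_z maximal_packing_def)
  next
    fix e' assume "e' \<in> insert e F"
    then consider "e' = e" | "e' \<in> F" by auto
    then show "\<exists>u\<in>e'. load (insert e F) z u = b u"
    proof cases
      case 1 then show ?thesis using u0 load_z[of u0] by (intro bexI[of _ u0]) auto
    next
      case 2
      then obtain u where u: "u \<in> e'" "load F y u = b u"
        using y by (auto simp: maximal_packing_def)
      then have "u \<in> e \<Longrightarrow> m = 0" using m_le[of u] m0 by simp
      then have "load (insert e F) z u = b u" using u by (simp add: load_z)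
      then show ?thesis using u by auto
    qed
  qed
  then show ?case by auto
qed

lemma maximal_packing_packing:
  assumes "finite F" "\<And>e. e \<in> F \<Longrightarrow> finite e \<and> e \<noteq> {}" "\<And>u. 0 \<le> b u"
  shows "maximal_packing F b (packing F b)"
  unfolding packing_def using maximal_packing_exists[OF assms] by (rule someI_ex)

lemma load_mono: "(\<And>e. e \<in> F \<Longrightarrow> y e \<le> z e) \<Longrightarrow> load F y u \<le> load F z u"
  unfolding load_def by (rule sum_mono) auto

lemma load_nonneg: "(\<And>e. e \<in> F \<Longrightarrow> 0 \<le> y e) \<Longrightarrow> 0 \<le> load F y u"
  unfolding load_def by (rule sum_nonneg) auto

lemma load_add: "load F (\<lambda>e. y e + z e) u = load F y u + load F z u"
  by (simp add: load_def sum.distrib)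

lemma load_cong: "(\<And>e. e \<in> F \<Longrightarrow> u \<in> e \<Longrightarrow> y e = z e) \<Longrightarrow> load F y u = load F z u"
  unfolding load_def by (rule sum.cong) auto

section \<open>Multiplicative weights on clusters, run in epochs\<close>

type_synonym cluster = "nat \<times> nat"
text \<open>A fractional matching and, for a vertex and a cluster, the number of iterations in which
  the cluster used up the whole offer of the vertex. The first component of a cluster is its
  scale.\<close>

type_synonym state = "(nat set \<Rightarrow> real) \<times> (nat \<Rightarrow> cluster \<Rightarrow> nat)"

definition members :: "nat set set \<Rightarrow> (nat set \<Rightarrow> cluster) \<Rightarrow> cluster \<Rightarrow> nat set set" where
  "members E cl g = {e \<in> E. cl e = g}"

definition clusters_at :: "nat set set \<Rightarrow> (nat set \<Rightarrow> cluster) \<Rightarrow> nat \<Rightarrow> nat \<Rightarrow> cluster set" where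
  "clusters_at E cl i u = {g \<in> cl ` {e \<in> E. u \<in> e}. fst g = i}"

definition pot ::
    "nat set set \<Rightarrow> (nat set \<Rightarrow> cluster) \<Rightarrow> nat \<Rightarrow> (nat \<Rightarrow> cluster \<Rightarrow> nat) \<Rightarrow> nat \<Rightarrow> nat \<Rightarrow> real" where
  "pot E cl R cnt i u = (\<Sum>g\<in>clusters_at E cl i u. real (Suc R) ^ cnt u g)"

text \<open>Each saturation multiplies the weight of a cluster by \<open>Suc R\<close>. An epoch has
  at most \<open>R\<close> iterations on each of \<open>R\<close> scales, so the factor
  \<open>1 / R^2\<close> keeps its total spending below the residual \<open>r u\<close>.\<close>

definition offer ::
    "nat set set \<Rightarrow> (nat set \<Rightarrow> cluster) \<Rightarrow> nat \<Rightarrow> (nat \<Rightarrow> real) \<Rightarrow>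
     (nat \<Rightarrow> cluster \<Rightarrow> nat) \<Rightarrow> cluster \<Rightarrow> nat \<Rightarrow> real" where
  "offer E cl R r cnt g u =
     (if g \<in> clusters_at E cl (fst g) u
      then r u / real R ^ 2 * real (Suc R) ^ cnt u g / pot E cl R cnt (fst g) u else 0)"

definition bid ::
    "nat set set \<Rightarrow> (nat set \<Rightarrow> cluster) \<Rightarrow> nat \<Rightarrow> (nat \<Rightarrow> real) \<Rightarrow>
     (nat \<Rightarrow> cluster \<Rightarrow> nat) \<Rightarrow> cluster \<Rightarrow> nat set \<Rightarrow> real" where
  "bid E cl R r cnt g = packing (members E cl g) (offer E cl R r cnt g)"

definition saturated ::
    "nat set set \<Rightarrow> (nat set \<Rightarrow> cluster) \<Rightarrow> nat \<Rightarrow> (nat \<Rightarrow> real) \<Rightarrow>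
     (nat \<Rightarrow> cluster \<Rightarrow> nat) \<Rightarrow> nat \<Rightarrow> cluster \<Rightarrow> bool" where
  "saturated E cl R r cnt u g \<longleftrightarrow> g \<in> clusters_at E cl (fst g) u \<and>
     load (members E cl g) (bid E cl R r cnt g) u = offer E cl R r cnt g u"

definition step ::
    "nat set set \<Rightarrow> (nat set \<Rightarrow> cluster) \<Rightarrow> nat \<Rightarrow> (nat \<Rightarrow> real) \<Rightarrow> state \<Rightarrow> state" where
  "step E cl R r s =
     (\<lambda>e. fst s e + bid E cl R r (snd s) (cl e) e,
      \<lambda>u g. snd s u g + of_bool (saturated E cl R r (snd s) u g))"

text \<open>An iteration on scale \<open>i\<close> takes O(i) rounds, so \<open>R div i\<close> of
  them take O(R) rounds on every scale. All runs start from the same state and residual, and each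
  edge keeps the outcome of the run for its own scale: the scales work in parallel.\<close>

fun epochs ::
    "nat set set \<Rightarrow> (nat \<Rightarrow> real) \<Rightarrow> (nat set \<Rightarrow> cluster) \<Rightarrow> nat \<Rightarrow> nat \<Rightarrow> state" where
  "epochs E w cl R 0 = (\<lambda>_. 0, \<lambda>_ _. 0)"
| "epochs E w cl R (Suc k) =
     (let s = epochs E w cl R k;
          r = (\<lambda>u. w u - load E (fst s) u);
          it = (\<lambda>i. (step E cl R r ^^ (R div i)) s)
      in (\<lambda>e. fst (it (fst (cl e))) e, \<lambda>u g. snd (it (fst g)) u g))"

definition residual ::
    "nat set set \<Rightarrow> (nat \<Rightarrow> real) \<Rightarrow> (nat set \<Rightarrow> cluster) \<Rightarrow> nat \<Rightarrow> nat \<Rightarrow> nat \<Rightarrow> real" where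
  "residual E w cl R k u = w u - load E (fst (epochs E w cl R k)) u"

definition layer :: "nat set set \<Rightarrow> (nat set \<Rightarrow> cluster) \<Rightarrow> nat \<Rightarrow> nat set set" where
  "layer E cl i = {e \<in> E. fst (cl e) = i}"

section \<open>Potential argument for the epochs\<close>

locale clustered_graph =
  fixes E :: "nat set set" and cl :: "nat set \<Rightarrow> cluster" and R :: nat
  assumes finite_edges: "finite E"
    and edge: "e \<in> E \<Longrightarrow> finite e \<and> e \<noteq> {}"
    and scale: "e \<in> E \<Longrightarrow> fst (cl e) \<in> {1..R}"
begin

lemma finite_clusters_at [simp]: "finite (clusters_at E cl i u)"
  using finite_edges by (simp add: clusters_at_def)

lemma members_subset: "members E cl g \<subseteq> E" by (auto simp: members_def)

lemma clusters_at_scale: "g \<in> clusters_at E cl i u \<Longrightarrow> i \<in> {1..R}"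
  using scale by (auto simp: clusters_at_def)

lemma load_layer:
  "load (layer E cl i) y u = (\<Sum>g\<in>clusters_at E cl i u. load (members E cl g) y u)"
proof -
  let ?S = "{e. e \<in> layer E cl i \<and> u \<in> e}"
  have "(\<Sum>g\<in>clusters_at E cl i u. sum y {e \<in> ?S. cl e = g}) = sum y ?S"
    by (rule sum.group) (use finite_edges in \<open>auto simp: layer_def clusters_at_def\<close>)
  moreover have "{e \<in> ?S. cl e = g} = {e. e \<in> members E cl g \<and> u \<in> e}"
    if "g \<in> clusters_at E cl i u" for g
    using that by (auto simp: layer_def members_def clusters_at_def)
  ultimately show ?thesis by (simp add: load_def)
qed

lemma load_split: "load E y u = (\<Sum>i=1..R. load (layer E cl i) y u)"
proof -
  let ?S = "{e. e \<in> E \<and> u \<in> e}"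
  have "(\<Sum>i\<in>{1..R}. sum y {e \<in> ?S. fst (cl e) = i}) = sum y ?S"
    by (rule sum.group) (use finite_edges scale in auto)
  moreover have "{e \<in> ?S. fst (cl e) = i} = {e. e \<in> layer E cl i \<and> u \<in> e}" for i
    by (auto simp: layer_def)
  ultimately show ?thesis by (simp add: load_def)
qed

lemma pot_pos: "g \<in> clusters_at E cl i u \<Longrightarrow> 0 < pot E cl R cnt i u"
  unfolding pot_def by (rule sum_pos) auto

lemma power_cnt_le_pot: "g \<in> clusters_at E cl i u \<Longrightarrow> real (Suc R) ^ cnt u g \<le> pot E cl R cnt i u"
  unfolding pot_def by (rule member_le_sum) auto

context
  fixes r :: "nat \<Rightarrow> real"
  assumes r_nonneg: "u \<in> \<Union>E \<Longrightarrow> 0 \<le> r u"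
begin

lemma offer_nonneg: "0 \<le> offer E cl R r cnt g u"
proof (cases "g \<in> clusters_at E cl (fst g) u")
  case True
  then have "u \<in> \<Union>E" by (auto simp: clusters_at_def)
  then show ?thesis using r_nonneg[of u] pot_pos[OF True, of cnt] True
    by (simp add: offer_def)
qed (simp add: offer_def)

lemma maximal_bid:
  "maximal_packing (members E cl g) (offer E cl R r cnt g) (bid E cl R r cnt g)"
  unfolding bid_def
proof (rule maximal_packing_packing)
  show "finite (members E cl g)" using members_subset finite_edges by (rule finite_subset)
  show "finite e \<and> e \<noteq> {}" if "e \<in> members E cl g" for e
    using that members_subset edge by blast
qed (rule offer_nonneg)

lemma bid_nonneg: "0 \<le> bid E cl R r cnt g e"
  using maximal_bid by (simp add: maximal_packing_def)

lemma step_mono: "fst s e \<le> fst (step E cl R r s) e"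
  using bid_nonneg by (simp add: step_def)

lemma load_layer_step:
  "load (layer E cl i) (fst (step E cl R r s)) u =
   load (layer E cl i) (fst s) u +
   (\<Sum>g\<in>clusters_at E cl i u. load (members E cl g) (bid E cl R r (snd s) g) u)"
proof -
  have "load (members E cl g) (\<lambda>e. bid E cl R r (snd s) (cl e) e) u
      = load (members E cl g) (bid E cl R r (snd s) g) u" for g
    by (rule load_cong) (auto simp: members_def)
  then show ?thesis by (simp add: step_def load_add load_layer)
qed

lemma load_layer_step_le:
  assumes "u \<in> \<Union>E"
  shows "load (layer E cl i) (fst (step E cl R r s)) u
     \<le> load (layer E cl i) (fst s) u + r u / real R ^ 2"
proof -
  let ?P = "pot E cl R (snd s) i u"
  have "(\<Sum>g\<in>clusters_at E cl i u. load (members E cl g) (bid E cl R r (snd s) g) u)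
      \<le> (\<Sum>g\<in>clusters_at E cl i u. r u / real R ^ 2 * real (Suc R) ^ snd s u g / ?P)"
  proof (rule sum_mono)
    fix g assume g: "g \<in> clusters_at E cl i u"
    then have "fst g = i" by (simp add: clusters_at_def)
    with g maximal_bid[of g "snd s"]
    show "load (members E cl g) (bid E cl R r (snd s) g) u
        \<le> r u / real R ^ 2 * real (Suc R) ^ snd s u g / ?P"
      by (auto simp: maximal_packing_def offer_def dest!: spec[of _ u])
  qed
  also have "\<dots> = r u / real R ^ 2 * (?P / ?P)"
    unfolding pot_def times_divide_eq_right sum_distrib_left sum_divide_distrib ..
  also have "\<dots> \<le> r u / real R ^ 2"
    using r_nonneg[OF assms] by (cases "?P = 0") auto
  finally show ?thesis by (simp add: load_layer_step)
qed

text \<open>A saturated cluster costs \<^term>\<open>u\<close> its whole offer, so the potential grows only at the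
  expense of the residual weight.\<close>

lemma pot_step:
  assumes "u \<in> \<Union>E" and "0 < r u"
  shows "pot E cl R (snd (step E cl R r s)) i u \<le> pot E cl R (snd s) i u *
    exp (real R ^ 3 / r u *
      (load (layer E cl i) (fst (step E cl R r s)) u - load (layer E cl i) (fst s) u))"
proof (cases "clusters_at E cl i u = {}")
  case True
  then show ?thesis by (simp add: pot_def)
next
  case False
  then obtain g0 where g0: "g0 \<in> clusters_at E cl i u" by auto
  let ?C = "clusters_at E cl i u" and ?P = "pot E cl R (snd s) i u"
  let ?sat = "saturated E cl R r (snd s) u"
  \<comment> \<open>\<open>X\<close> is the part of the potential in saturated clusters. Saturation
    multiplies a term by \<open>Suc R\<close>, so the potential gains \<open>R * X\<close>; the same
    clusters take \<open>r u / (R^2 * ?P) * X\<close> from \<open>u\<close>, which is at most the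
    spent load \<open>D\<close>.\<close>
  define X where "X = (\<Sum>g\<in>?C. of_bool (?sat g) * real (Suc R) ^ snd s u g)"
  define D where "D = load (layer E cl i) (fst (step E cl R r s)) u - load (layer E cl i) (fst s) u"
  have P: "0 < ?P" using pot_pos[OF g0] .
  have R: "0 < real R" using clusters_at_scale[OF g0] by simp
  have "pot E cl R (snd (step E cl R r s)) i u
      = (\<Sum>g\<in>?C. real (Suc R) ^ snd s u g + real R * (of_bool (?sat g) * real (Suc R) ^ snd s u g))"
    unfolding pot_def step_def by (rule sum.cong) (auto simp: algebra_simps)
  also have "\<dots> = ?P + real R * X"
    unfolding pot_def X_def sum.distrib sum_distrib_left ..
  finally have pot: "pot E cl R (snd (step E cl R r s)) i u = ?P + real R * X" .
  have "r u / real R ^ 2 / ?P * X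
      = (\<Sum>g\<in>?C. of_bool (?sat g) * (r u / real R ^ 2 * real (Suc R) ^ snd s u g / ?P))"
    unfolding X_def sum_distrib_left by (rule sum.cong) auto
  also have "\<dots> \<le> (\<Sum>g\<in>?C. load (members E cl g) (bid E cl R r (snd s) g) u)"
  proof (rule sum_mono)
    fix g assume g: "g \<in> ?C"
    then have i: "fst g = i" by (simp add: clusters_at_def)
    show "of_bool (?sat g) * (r u / real R ^ 2 * real (Suc R) ^ snd s u g / ?P)
        \<le> load (members E cl g) (bid E cl R r (snd s) g) u"
    proof (cases "?sat g")
      case True
      then show ?thesis using g i by (simp add: saturated_def offer_def)
    next
      case False
      then show ?thesis by (simp add: load_nonneg bid_nonneg)
    qed
  qed
  also have "\<dots> = D" by (simp add: D_def load_layer_step)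
  finally have "r u / real R ^ 2 / ?P * X \<le> D" .
  then have "real R * X \<le> ?P * (real R ^ 3 / r u * D)"
    using P R assms(2) by (simp add: field_simps power2_eq_square power3_eq_cube)
  then have "pot E cl R (snd (step E cl R r s)) i u \<le> ?P * (1 + real R ^ 3 / r u * D)"
    by (simp add: pot algebra_simps)
  also have "\<dots> \<le> ?P * exp (real R ^ 3 / r u * D)"
    using P by (intro mult_left_mono exp_ge_add_one_self) auto
  finally show ?thesis by (simp add: D_def)
qed

text \<open>Maximality of the bid is used here: an edge with two unsaturated endpoints could still
  be raised.\<close>

lemma edge_saturated:
  assumes "e \<in> E"
  shows "\<exists>u\<in>e. saturated E cl R r cnt u (cl e)"
proof -
  have "e \<in> members E cl (cl e)" using assms by (simp add: members_def)
  then obtain u where "u \<in> e"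
    "load (members E cl (cl e)) (bid E cl R r cnt (cl e)) u = offer E cl R r cnt (cl e) u"
    using maximal_bid[of "cl e" cnt] unfolding maximal_packing_def by blast
  moreover have "cl e \<in> clusters_at E cl (fst (cl e)) u"
    using assms \<open>u \<in> e\<close> by (auto simp: clusters_at_def)
  ultimately show ?thesis by (auto simp: saturated_def)
qed

lemma load_layer_steps:
  assumes "u \<in> \<Union>E"
  shows "load (layer E cl i) (fst ((step E cl R r ^^ m) s)) u
      \<in> {load (layer E cl i) (fst s) u .. load (layer E cl i) (fst s) u + m * (r u / real R ^ 2)}"
proof (induction m)
  case (Suc m)
  let ?t = "(step E cl R r ^^ m) s"
  have "load (layer E cl i) (fst ?t) u \<le> load (layer E cl i) (fst (step E cl R r ?t)) u"
    by (rule load_mono) (rule step_mono)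
  moreover have "load (layer E cl i) (fst (step E cl R r ?t)) u
      \<le> load (layer E cl i) (fst ?t) u + r u / real R ^ 2"
    by (rule load_layer_step_le[OF assms])
  moreover have "real (Suc m) * (r u / real R ^ 2) = real m * (r u / real R ^ 2) + r u / real R ^ 2"
    by (simp only: of_nat_Suc distrib_right mult_1_left add.commute)
  ultimately show ?case using Suc unfolding atLeastAtMost_iff funpow.simps comp_apply by linarith
qed simp

lemma steps_mono: "fst s e \<le> fst ((step E cl R r ^^ m) s) e"
  by (induction m) (auto intro: order_trans[OF _ step_mono])

text \<open>The residual \<open>r\<close> is fixed during an epoch, so the exponents of
  \<open>pot_step\<close> telescope.\<close>

lemma pot_steps:
  assumes "u \<in> \<Union>E" and "0 < r u"
  shows "pot E cl R (snd ((step E cl R r ^^ m) s)) i u \<le> pot E cl R (snd s) i u *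
    exp (real R ^ 3 / r u * (load (layer E cl i) (fst ((step E cl R r ^^ m) s)) u
                            - load (layer E cl i) (fst s) u))"
proof (induction m)
  case (Suc m)
  let ?t = "(step E cl R r ^^ m) s"
  have "pot E cl R (snd (step E cl R r ?t)) i u \<le> pot E cl R (snd ?t) i u *
    exp (real R ^ 3 / r u * (load (layer E cl i) (fst (step E cl R r ?t)) u
                            - load (layer E cl i) (fst ?t) u))"
    by (rule pot_step[OF assms])
  also have "\<dots> \<le> (pot E cl R (snd s) i u *
    exp (real R ^ 3 / r u * (load (layer E cl i) (fst ?t) u - load (layer E cl i) (fst s) u))) *
    exp (real R ^ 3 / r u * (load (layer E cl i) (fst (step E cl R r ?t)) u
                            - load (layer E cl i) (fst ?t) u))"
    by (rule mult_right_mono[OF Suc]) simp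
  also have "\<dots> = pot E cl R (snd s) i u *
    exp (real R ^ 3 / r u * (load (layer E cl i) (fst (step E cl R r ?t)) u
                            - load (layer E cl i) (fst s) u))"
    unfolding mult.assoc exp_add[symmetric] distrib_left[symmetric] by simp
  finally show ?case by simp
qed simp

lemma edge_count_steps:
  assumes "e \<in> E"
  shows "(\<Sum>u\<in>e. snd s u (cl e)) + m \<le> (\<Sum>u\<in>e. snd ((step E cl R r ^^ m) s) u (cl e))"
proof (induction m)
  case (Suc m)
  let ?t = "(step E cl R r ^^ m) s"
  obtain v where v: "v \<in> e" "saturated E cl R r (snd ?t) v (cl e)"
    using edge_saturated[OF assms] by blast
  have "(\<Sum>u\<in>e. snd ?t u (cl e)) + 1 \<le>
      (\<Sum>u\<in>e. snd ?t u (cl e)) + (\<Sum>u\<in>e. of_bool (saturated E cl R r (snd ?t) u (cl e)))"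
    using v edge[OF assms] member_le_sum[of v e "\<lambda>u. of_bool (saturated E cl R r (snd ?t) u (cl e)) :: nat"]
    by simp
  also have "\<dots> = (\<Sum>u\<in>e. snd (step E cl R r ?t) u (cl e))"
    by (simp add: step_def sum.distrib)
  finally show ?case using Suc by simp
qed simp

end

context
  fixes w :: "nat \<Rightarrow> real"
  assumes w_nonneg: "u \<in> \<Union>E \<Longrightarrow> 0 \<le> w u"
begin

abbreviation "Y k \<equiv> fst (epochs E w cl R k)"
abbreviation "cnt k \<equiv> snd (epochs E w cl R k)"
abbreviation "res k \<equiv> residual E w cl R k"
abbreviation "iter k i \<equiv> (step E cl R (res k) ^^ (R div i)) (epochs E w cl R k)"

lemma epochs_Suc:
  "Y (Suc k) e = fst (iter k (fst (cl e))) e"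
  "cnt (Suc k) u g = snd (iter k (fst g)) u g"
  by (simp_all add: residual_def[abs_def] Let_def)

declare epochs.simps(2) [simp del]

lemma load_layer_Suc: "load (layer E cl i) (Y (Suc k)) u = load (layer E cl i) (fst (iter k i)) u"
  by (rule load_cong) (auto simp: layer_def epochs_Suc)

lemma pot_Suc: "pot E cl R (cnt (Suc k)) i u = pot E cl R (snd (iter k i)) i u"
  unfolding pot_def by (rule sum.cong) (auto simp: clusters_at_def epochs_Suc)

text \<open>\<open>R\<close> scales with at most \<open>R\<close> iterations each spend at most
  \<open>res k u / R^2\<close> per iteration, together at most the residual. No scale spends a
  negative amount, so each one spends at most the total.\<close>

lemma residual_Suc:
  assumes nn: "\<And>u. u \<in> \<Union>E \<Longrightarrow> 0 \<le> res k u" and u: "u \<in> \<Union>E"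
  shows "0 \<le> res (Suc k) u"
    and "load (layer E cl i) (Y (Suc k)) u - load (layer E cl i) (Y k) u \<le> res k u - res (Suc k) u"
proof -
  define D where "D i = load (layer E cl i) (Y (Suc k)) u - load (layer E cl i) (Y k) u" for i
  have *: "D i \<in> {0 .. real (R div i) * (res k u / real R ^ 2)}" for i
    using load_layer_steps[of "res k" u i "R div i" "epochs E w cl R k"] nn u
    by (auto simp: D_def load_layer_Suc)
  have split: "res k u - res (Suc k) u = (\<Sum>i=1..R. D i)"
    by (simp add: residual_def load_split D_def sum_subtractf)
  have "R \<noteq> 0" using u scale by force
  have "(\<Sum>i=1..R. D i) \<le> (\<Sum>i=1..R. real R * (res k u / real R ^ 2))"
  proof (rule sum_mono)
    fix i
    have "D i \<le> real (R div i) * (res k u / real R ^ 2)" using * by auto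
    also have "\<dots> \<le> real R * (res k u / real R ^ 2)"
      using nn[OF u] by (intro mult_right_mono) auto
    finally show "D i \<le> real R * (res k u / real R ^ 2)" .
  qed
  also have "\<dots> = res k u" using \<open>R \<noteq> 0\<close> by (simp add: power2_eq_square)
  finally show "0 \<le> res (Suc k) u" using split by linarith
  show "D i \<le> res k u - res (Suc k) u"
  proof (cases "i \<in> {1..R}")
    case True
    have "0 \<le> D j" for j using * by auto
    then show ?thesis unfolding split using True by (intro member_le_sum) auto
  next
    case False
    then have "layer E cl i = {}" using scale by (auto simp: layer_def)
    then have "D i = 0" by (simp add: D_def load_def)
    moreover have "0 \<le> (\<Sum>i=1..R. D i)" using * by (intro sum_nonneg) auto
    ultimately show ?thesis using split by simp
  qed
qed

lemma residual_nonneg: "u \<in> \<Union>E \<Longrightarrow> 0 \<le> res k u"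
proof (induction k arbitrary: u)
  case 0
  then show ?case using w_nonneg by (simp add: residual_def load_def)
next
  case (Suc k)
  show ?case by (rule residual_Suc(1)) (use Suc in auto)
qed

lemma Y_mono: "Y k e \<le> Y (Suc k) e"
  unfolding epochs_Suc by (rule steps_mono) (rule residual_nonneg)

lemma Y_nonneg: "0 \<le> Y k e"
  by (induction k) (auto intro: order_trans[OF _ Y_mono])

lemma residual_antimono: "res (Suc k) u \<le> res k u"
  unfolding residual_def using load_mono[of E "Y k" "Y (Suc k)" u] Y_mono by simp

text \<open>The left side does not increase from epoch to epoch: with
  \<open>x = res (Suc k) u / res k u\<close> the potential grows at most by the factor
  \<open>exp (R^3 * (1 - x))\<close>, the power of the residual shrinks by \<open>x ^ (R^3)\<close>,
  and \<open>x * exp (1 - x) \<le> 1\<close>. Initially all counters are 0 and the residual is the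
  weight.\<close>

lemma pot_residual:
  assumes u: "u \<in> \<Union>E"
  shows "pot E cl R (cnt k) i u * res k u ^ (R ^ 3)
      \<le> real (card (clusters_at E cl i u)) * w u ^ (R ^ 3)"
proof (induction k)
  case 0
  then show ?case by (simp add: pot_def residual_def load_def)
next
  case (Suc k)
  let ?p = "pot E cl R (cnt k) i u" and ?q = "res (Suc k) u" and ?r = "res k u"
  have q: "0 \<le> ?q" "?q \<le> ?r" using residual_nonneg[OF u] residual_antimono by auto
  have p: "0 \<le> ?p" unfolding pot_def by (rule sum_nonneg) simp
  have "pot E cl R (cnt (Suc k)) i u * ?q ^ (R ^ 3) \<le> ?p * ?r ^ (R ^ 3)"
  proof (cases "?r = 0")
    case True
    then have "?q = 0" using q by simp
    moreover have "0 < R ^ 3" using scale u by force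
    ultimately show ?thesis using True by (simp only: zero_power mult_zero_right order_refl)
  next
    case False
    then have r: "0 < ?r" using q by simp
    let ?D = "load (layer E cl i) (Y (Suc k)) u - load (layer E cl i) (Y k) u"
    have D: "?D \<le> ?r - ?q" by (rule residual_Suc(2)) (use residual_nonneg u in auto)
    have "pot E cl R (cnt (Suc k)) i u \<le> ?p * exp (real R ^ 3 / ?r * ?D)"
      using pot_steps[of "res k" u "R div i" "epochs E w cl R k" i] residual_nonneg u r
      by (simp add: pot_Suc load_layer_Suc)
    also have "\<dots> \<le> ?p * exp (real R ^ 3 / ?r * (?r - ?q))"
    proof (rule mult_left_mono[OF _ p])
      have "0 \<le> real R ^ 3 / ?r" using r by simp
      then show "exp (real R ^ 3 / ?r * ?D) \<le> exp (real R ^ 3 / ?r * (?r - ?q))"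
        unfolding exp_le_cancel_iff by (rule mult_left_mono[OF D])
    qed
    also have "real R ^ 3 / ?r * (?r - ?q) = real (R ^ 3) * (1 - ?q / ?r)"
      using r by (simp add: field_simps)
    also have "exp (real (R ^ 3) * (1 - ?q / ?r)) = exp (1 - ?q / ?r) ^ (R ^ 3)"
      by (rule exp_of_nat_mult)
    finally have "pot E cl R (cnt (Suc k)) i u * ?q ^ (R ^ 3)
        \<le> ?p * exp (1 - ?q / ?r) ^ (R ^ 3) * ?q ^ (R ^ 3)"
      using q by (intro mult_right_mono) auto
    also have "\<dots> = ?p * (exp (1 - ?q / ?r) * ?q) ^ (R ^ 3)"
      by (simp add: power_mult_distrib)
    also have "exp (1 - ?q / ?r) * ?q \<le> ?r"
    proof -
      have "?q / ?r \<le> exp (?q / ?r - 1)" using exp_ge_add_one_self[of "?q / ?r - 1"] by simp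
      then have "?q / ?r * exp (1 - ?q / ?r) \<le> exp (?q / ?r - 1) * exp (1 - ?q / ?r)"
        by (rule mult_right_mono) simp
      also have "\<dots> = 1" by (simp add: exp_add[symmetric])
      finally show ?thesis using r by (simp add: field_simps)
    qed
    then have "?p * (exp (1 - ?q / ?r) * ?q) ^ (R ^ 3) \<le> ?p * ?r ^ (R ^ 3)"
      using p q by (intro mult_left_mono power_mono) auto
    finally show ?thesis .
  qed
  then show ?case using Suc by simp
qed

lemma edge_count:
  assumes "e \<in> E"
  shows "k * (R div fst (cl e)) \<le> (\<Sum>u\<in>e. cnt k u (cl e))"
proof (induction k)
  case (Suc k)
  then show ?case
    using edge_count_steps[of "res k" e "epochs E w cl R k" "R div fst (cl e)"] residual_nonneg assms
    by (simp add: epochs_Suc)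
qed simp

text \<open>Every iteration of its cluster saturates an endpoint of an edge, so a long enough run
  exhausts one of the two potentials.\<close>

lemma edge_covered:
  assumes e: "e \<in> E" "card e = 2" and \<delta>: "0 < \<delta>"
    and \<kappa>: "\<And>u. u \<in> e \<Longrightarrow> real (card (clusters_at E cl (fst (cl e)) u)) \<le> \<kappa>"
    and N: "(\<kappa> * (1 / \<delta>) ^ (R ^ 3)) ^ 2 < real (Suc R) ^ (N * (R div fst (cl e)))"
  shows "\<exists>u\<in>e. (1 - \<delta>) * w u \<le> load E (Y N) u"
proof (rule ccontr)
  assume "\<not> ?thesis"
  then have *: "\<delta> * w u < res N u" if "u \<in> e" for u
    using that by (auto simp: residual_def algebra_simps not_le)
  let ?B = "\<kappa> * (1 / \<delta>) ^ (R ^ 3)"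
  \<comment> \<open>An endpoint that keeps more than the fraction \<open>\<delta>\<close> of its
    weight has potential at most \<open>?B\<close> by \<open>pot_residual\<close>, and a potential
    dominates each of its terms.\<close>
  have bound: "real (Suc R) ^ cnt N u (cl e) \<le> ?B" if u: "u \<in> e" for u
  proof -
    have uE: "u \<in> \<Union>E" using e u by auto
    have g: "cl e \<in> clusters_at E cl (fst (cl e)) u" using e u by (auto simp: clusters_at_def)
    have w: "0 \<le> w u" using w_nonneg uE .
    then have r: "0 < res N u" using *[OF u] \<delta> by (smt (verit) mult_nonneg_nonneg)
    let ?p = "pot E cl R (cnt N) (fst (cl e)) u"
    have "?p * res N u ^ (R ^ 3) \<le> \<kappa> * w u ^ (R ^ 3)"
      using pot_residual[OF uE, of N "fst (cl e)"] mult_right_mono[OF \<kappa>[OF u], of "w u ^ (R ^ 3)"] w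
      by simp
    also have "\<dots> \<le> \<kappa> * (res N u / \<delta>) ^ (R ^ 3)"
    proof -
      have "0 \<le> \<kappa>" using \<kappa>[OF u] by (smt (verit) of_nat_0_le_iff)
      moreover have "w u \<le> res N u / \<delta>" using *[OF u] \<delta> by (simp add: field_simps)
      ultimately show ?thesis using w by (intro mult_left_mono power_mono) auto
    qed
    also have "\<dots> = ?B * res N u ^ (R ^ 3)" by (simp add: power_divide)
    finally have "?p \<le> ?B" using r by (meson mult_le_cancel_right_pos zero_less_power)
    then show ?thesis using power_cnt_le_pot[OF g, of "cnt N"] by simp
  qed
  \<comment> \<open>The counters of the two endpoints sum to at least the number of iterations, so
    two powers bounded by \<open>?B\<close> contradict the choice of \<open>N\<close>.\<close>
  have "real (Suc R) ^ (N * (R div fst (cl e))) \<le> real (Suc R) ^ (\<Sum>u\<in>e. cnt N u (cl e))"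
    using edge_count[OF e(1)] by (intro power_increasing) auto
  also have "\<dots> = (\<Prod>u\<in>e. real (Suc R) ^ cnt N u (cl e))" by (rule power_sum)
  also have "\<dots> \<le> (\<Prod>u\<in>e. ?B)" by (rule prod_mono) (use bound in auto)
  also have "\<dots> = ?B ^ 2" using e by simp
  finally show False using N by simp
qed

end

end

section \<open>Weak duality between packings and vertex covers\<close>

lemma packing_le_cover:
  assumes "finite E" "\<And>e. e \<in> E \<Longrightarrow> 0 \<le> y e" "is_vertex_cover V E S" "finite V"
    and "\<And>u. u \<in> V \<Longrightarrow> load E y u \<le> w u"
  shows "sum y E \<le> sum w S"
proof -
  have S: "finite S" "S \<subseteq> V" using assms by (auto simp: is_vertex_cover_def intro: finite_subset)
  \<comment> \<open>Each edge charges its value to a cover vertex on it.\<close>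
  have "sum y E \<le> (\<Sum>e\<in>E. \<Sum>u | u \<in> S \<and> u \<in> e. y e)"
  proof (rule sum_mono)
    fix e assume e: "e \<in> E"
    then obtain u where "u \<in> S" "u \<in> e" using assms(3) by (auto simp: is_vertex_cover_def)
    then show "y e \<le> (\<Sum>u | u \<in> S \<and> u \<in> e. y e)"
      using member_le_sum[of u "{u. u \<in> S \<and> u \<in> e}" "\<lambda>_. y e"] S assms(2)[OF e] by simp
  qed
  also have "\<dots> = (\<Sum>u\<in>S. load E y u)"
    unfolding load_def by (rule sum.swap_restrict) (use S assms in auto)
  also have "\<dots> \<le> sum w S" by (rule sum_mono) (use S assms in auto)
  finally show ?thesis .
qed

lemma sum_load:
  assumes "finite E" "finite V" "\<And>e. e \<in> E \<Longrightarrow> e \<subseteq> V \<and> card e = 2"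
  shows "(\<Sum>u\<in>V. load E y u) = 2 * sum y E"
proof -
  have "(\<Sum>u\<in>V. load E y u) = (\<Sum>e\<in>E. \<Sum>u | u \<in> V \<and> u \<in> e. y e)"
    unfolding load_def by (rule sum.swap_restrict[symmetric]) (use assms in auto)
  also have "\<dots> = (\<Sum>e\<in>E. 2 * y e)"
  proof (rule sum.cong)
    fix e assume "e \<in> E"
    moreover from this have "{u. u \<in> V \<and> u \<in> e} = e" using assms by auto
    ultimately show "(\<Sum>u | u \<in> V \<and> u \<in> e. y e) = 2 * y e" using assms by simp
  qed simp
  finally show ?thesis by (simp add: sum_distrib_left)
qed

section \<open>Balls, views and clusters\<close>

lemma adjrel_sym: "(x, y) \<in> adjrel E \<longleftrightarrow> (y, x) \<in> adjrel E"
  by (simp add: adjrel_def insert_commute)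

lemma relpow_adjrel_sym: "(x, y) \<in> adjrel E ^^ k \<longleftrightarrow> (y, x) \<in> adjrel E ^^ k"
proof (induction k arbitrary: x y)
  case (Suc k)
  have "(x, y) \<in> adjrel E ^^ Suc k \<longleftrightarrow> (\<exists>z. (x, z) \<in> adjrel E ^^ k \<and> (z, y) \<in> adjrel E)"
    by auto
  also have "\<dots> \<longleftrightarrow> (\<exists>z. (y, z) \<in> adjrel E \<and> (z, x) \<in> adjrel E ^^ k)"
    using Suc[of x] adjrel_sym[of _ y] by blast
  also have "\<dots> \<longleftrightarrow> (y, x) \<in> adjrel E ^^ Suc k"
    by (meson relpow_Suc_D2 relpow_Suc_I2)
  finally show ?case .
qed auto

lemma ball_sym: "x \<in> ball_G E k y \<longleftrightarrow> y \<in> ball_G E k x"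
  unfolding ball_G_def mem_Collect_eq using relpow_adjrel_sym[of x y _ E] by blast

lemma ball_self [simp]: "v \<in> ball_G E k v"
  by (auto simp: ball_G_def intro: exI[of _ 0])

lemma ball_mono: "j \<le> k \<Longrightarrow> ball_G E j v \<subseteq> ball_G E k v"
  unfolding ball_G_def using order_trans by blast

lemma ball_trans: "u \<in> ball_G E j v \<Longrightarrow> x \<in> ball_G E k u \<Longrightarrow> x \<in> ball_G E (j + k) v"
  unfolding ball_G_def mem_Collect_eq by (meson add_mono relpow_trans)

lemma ball_trans': "u \<in> ball_G E j v \<Longrightarrow> x \<in> ball_G E k u \<Longrightarrow> j + k \<le> m \<Longrightarrow> x \<in> ball_G E m v"
  using ball_trans ball_mono by blast

lemma graph_edge:
  assumes "graph V E" "e \<in> E"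
  shows "e \<subseteq> V" "card e = 2" "finite e" "e \<noteq> {}"
  using assms by (auto simp: graph_def)

lemma graph_finite: "graph V E \<Longrightarrow> finite V \<and> finite E"
  using graph_edge(1)[of V E] by (auto simp: graph_def intro: finite_subset[of E "Pow V"])

lemma edge_in_ball:
  assumes "graph V E" "e \<in> E" "x \<in> e" "y \<in> e"
  shows "y \<in> ball_G E 1 x"
proof (cases "x = y")
  case False
  then have "e = {x, y}" using assms by (auto simp: graph_def)
  then have "(x, y) \<in> adjrel E" using assms by (simp add: adjrel_def)
  then show ?thesis unfolding ball_G_def by (auto intro!: exI[of _ 1])
qed simp

lemma ball_subset:
  assumes "graph V E" "v \<in> V"
  shows "ball_G E k v \<subseteq> V"
proof -
  have "(v, x) \<in> adjrel E ^^ j \<Longrightarrow> x \<in> V" for x j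
  proof (induction j arbitrary: x)
    case (Suc j)
    then obtain z where "(z, x) \<in> adjrel E" by auto
    then show ?case using graph_edge(1)[OF assms(1)] by (auto simp: adjrel_def)
  qed (use assms in auto)
  then show ?thesis by (auto simp: ball_G_def)
qed

text \<open>A mark \<^term>\<open>(v, k)\<close> says that \<^term>\<open>v\<close> may be a center for balls of \<^term>\<open>k\<close> vertices. The
  algorithm uses its randomness only through these finitely many marks, which makes its success
  event measurable.\<close>

definition same_view ::
    "nat \<Rightarrow> nat \<Rightarrow> nat set set \<Rightarrow> (nat \<Rightarrow> real) \<Rightarrow> (nat \<times> nat) set \<Rightarrow>
     nat set set \<Rightarrow> (nat \<Rightarrow> real) \<Rightarrow> (nat \<times> nat) set \<Rightarrow> bool" where
  "same_view T v E w M E' w' M' \<longleftrightarrow> ball_G E T v = ball_G E' T v \<and>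
     (\<forall>u\<in>ball_G E T v. w u = w' u \<and> (\<forall>k. (u, k) \<in> M \<longleftrightarrow> (u, k) \<in> M')) \<and>
     (\<forall>x\<in>ball_G E T v. \<forall>y\<in>ball_G E T v. {x, y} \<in> E \<longleftrightarrow> {x, y} \<in> E')"

lemma same_view_sym: "same_view T v E w M E' w' M' \<Longrightarrow> same_view T v E' w' M' E w M"
  by (simp add: same_view_def)

text \<open>A walk of at most \<open>a\<close> edges that starts within distance \<open>b\<close> of
  \<open>v\<close> stays within distance \<open>a + b\<close>, where both graphs have the same
  edges.\<close>

lemma same_view_relpow:
  assumes "same_view (a + b) v E w M E' w' M'" "u \<in> ball_G E b v" "k \<le> a" "(u, x) \<in> adjrel E ^^ k"
  shows "(u, x) \<in> adjrel E' ^^ k"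
  using assms(3,4)
proof (induction k arbitrary: x)
  case (Suc k)
  then obtain z where z: "(u, z) \<in> adjrel E ^^ k" "(z, x) \<in> adjrel E" by auto
  have "z \<in> ball_G E k u" "x \<in> ball_G E (Suc k) u"
    using z(1) Suc.prems(2) by (auto simp: ball_G_def simp del: relpow.simps)
  then have "z \<in> ball_G E (a + b) v" "x \<in> ball_G E (a + b) v"
    using Suc.prems(1) by (auto intro: ball_trans'[OF assms(2)])
  then have "(z, x) \<in> adjrel E'"
    using assms(1) z(2) by (simp add: same_view_def adjrel_def)
  moreover have "(u, z) \<in> adjrel E' ^^ k" using Suc.IH[OF _ z(1)] Suc.prems(1) by simp
  ultimately show ?case by auto
qed simp

lemma same_view_ball:
  assumes sv: "same_view (a + b) v E w M E' w' M'" and u: "u \<in> ball_G E b v" and "k \<le> a"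
  shows "ball_G E k u = ball_G E' k u"
proof -
  \<comment> \<open>Walks from \<open>v\<close> transfer first, which puts \<open>u\<close> in the
    ball of the other graph; then walks from \<open>u\<close> transfer in both directions.\<close>
  have "same_view (a + b) v F z L F' z' L' \<Longrightarrow> ball_G F b v \<subseteq> ball_G F' b v" for F F' z z' L L'
    using same_view_relpow[of "a + b" 0 v F z L F' z' L' v] by (auto simp: ball_G_def)
  then have u': "u \<in> ball_G E' b v" using sv u by blast
  show ?thesis
    using same_view_relpow[OF sv u] same_view_relpow[OF same_view_sym[OF sv] u'] assms(3) order_trans
    unfolding ball_G_def by blast
qed

lemma same_view_sub:
  assumes sv: "same_view k v E w M E' w' M'" and u: "u \<in> ball_G E b v" and k: "a + b \<le> k"
  shows "same_view a u E w M E' w' M'"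
proof -
  have "ball_G E a u \<subseteq> ball_G E k v" using ball_trans'[OF u] k by auto
  moreover have "ball_G E a u = ball_G E' a u"
    by (rule same_view_ball[of "k - b" b v]) (use sv u k in auto)
  ultimately show ?thesis using sv unfolding same_view_def by (meson subset_iff)
qed

lemma same_view_balls:
  assumes "same_view k v E w M E' w' M'" "j \<le> k"
  shows "ball_G E j v = ball_G E' j v"
  using same_view_ball[of k 0 v E w M E' w' M' v j] assms by simp

lemma same_view_edge:
  assumes "same_view k v E w M E' w' M'" "1 \<le> k" "graph V E" "v \<in> e" "e \<in> E"
  shows "e \<in> E'"
proof -
  obtain x where "e = {v, x}" using assms by (auto simp: graph_def)
  moreover have "x \<in> ball_G E k v"
    using edge_in_ball[OF assms(3,5), of v x] ball_mono[OF assms(2)] \<open>e = {v, x}\<close> by auto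
  moreover have "v \<in> ball_G E k v" by simp
  ultimately show ?thesis using assms(1,5) unfolding same_view_def by blast
qed

section \<open>Scales, centers and the clustering of the edges\<close>

definition growth :: "nat \<Rightarrow> nat \<Rightarrow> nat \<Rightarrow> real" where
  "growth n R i = real n powr (1 / (real i * harm R))"

definition scale_of :: "nat \<Rightarrow> nat \<Rightarrow> nat set set \<Rightarrow> nat \<Rightarrow> nat" where
  "scale_of n R E v = (LEAST i. i \<in> {1..R} \<and>
     real (card (ball_G E (2 * i + 2) v)) \<le> growth n R i * real (card (ball_G E (2 * i) v)))"

text \<open>The candidates are the vertices of the ball that are marked for its own size. Without a
  candidate the center is \<open>v\<close>, so it lies in the ball for every set of marks.\<close>

definition center :: "nat set set \<Rightarrow> (nat \<times> nat) set \<Rightarrow> nat \<Rightarrow> nat \<Rightarrow> nat" where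
  "center E M i v = (let C = {c \<in> ball_G E (2 * i) v. (c, card (ball_G E (2 * i) v)) \<in> M}
                     in if C = {} then v else LEAST c. c \<in> C)"

text \<open>The smaller endpoint decides for an edge, which puts every edge in exactly one cluster;
  with the scale in the pair, edges of different scales never share one.\<close>

definition cluster :: "nat \<Rightarrow> nat \<Rightarrow> nat set set \<Rightarrow> (nat \<times> nat) set \<Rightarrow> nat set \<Rightarrow> cluster" where
  "cluster n R E M e =
     (scale_of n R E (Min e), center E M (scale_of n R E (Min e)) (Min e))"

lemma center_in_ball: "center E M i v \<in> ball_G E (2 * i) v"
proof -
  let ?C = "{c \<in> ball_G E (2 * i) v. (c, card (ball_G E (2 * i) v)) \<in> M}"
  show ?thesis
  proof (cases "?C = {}")
    case False
    then obtain c where "c \<in> ?C" by blast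
    then have "(LEAST c. c \<in> ?C) \<in> ?C" by (rule LeastI)
    then show ?thesis using False by (simp add: center_def Let_def)
  qed (simp add: center_def Let_def)
qed

lemma scale_of_local:
  assumes "same_view (2 * R + 2) v E w M E' w' M'"
  shows "scale_of n R E v = scale_of n R E' v"
proof -
  have "ball_G E (2 * i + 2) v = ball_G E' (2 * i + 2) v \<and> ball_G E (2 * i) v = ball_G E' (2 * i) v"
    if "i \<in> {1..R}" for i
    using that by (intro conjI same_view_balls[OF assms]) auto
  then show ?thesis unfolding scale_of_def by (intro arg_cong[of _ _ Least] ext) auto
qed

lemma center_local:
  assumes "same_view (2 * i) v E w M E' w' M'"
  shows "center E M i v = center E' M' i v"
proof -
  have "ball_G E (2 * i) v = ball_G E' (2 * i) v" by (rule same_view_balls[OF assms]) simp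
  then have "{c \<in> ball_G E (2 * i) v. (c, card (ball_G E (2 * i) v)) \<in> M}
      = {c \<in> ball_G E' (2 * i) v. (c, card (ball_G E' (2 * i) v)) \<in> M'}"
    using assms by (auto simp: same_view_def)
  then show ?thesis by (simp add: center_def)
qed

lemma same_view_mono: "same_view k v E w M E' w' M' \<Longrightarrow> j \<le> k \<Longrightarrow> same_view j v E w M E' w' M'"
  using same_view_sub[of k v E w M E' w' M' v 0 j] by simp

section \<open>Locality: two inputs compared at vertices with equal views\<close>

locale two_views =
  fixes n R :: nat
    and V E and w :: "nat \<Rightarrow> real" and M :: "(nat \<times> nat) set"
    and V' E' and w' :: "nat \<Rightarrow> real" and M' :: "(nat \<times> nat) set"
  assumes G: "graph V E" and G': "graph V' E'"
    and scales: "\<And>v. v \<in> V \<Longrightarrow> scale_of n R E v \<in> {1..R}"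
    and scales': "\<And>v. v \<in> V' \<Longrightarrow> scale_of n R E' v \<in> {1..R}"
begin

abbreviation "view T v \<equiv> same_view T v E w M E' w' M'"
abbreviation "cl \<equiv> cluster n R E M"
abbreviation "cl' \<equiv> cluster n R E' M'"

lemma Min_edge: "e \<in> E \<Longrightarrow> Min e \<in> e"
  using graph_edge[OF G] by (intro Min_in) auto

text \<open>One hop leads to \<open>Min e\<close>, whose scale depends on balls of radius up to
  \<open>2 * R + 2\<close>; these contain the candidates for its center.\<close>

lemma cluster_local:
  assumes v: "view (2 * R + 3) v" and e: "v \<in> e" "e \<in> E"
  shows "e \<in> E'" "cl e = cl' e"
proof -
  show "e \<in> E'" by (rule same_view_edge[OF v _ G e]) simp
  have x: "view (2 * R + 2) (Min e)"
    by (rule same_view_sub[OF v edge_in_ball[OF G e(2,1) Min_edge[OF e(2)]]]) simp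
  have s: "scale_of n R E (Min e) \<in> {1..R}"
    using graph_edge(1)[OF G e(2)] Min_edge[OF e(2)] by (intro scales) auto
  have "view (2 * scale_of n R E (Min e)) (Min e)"
    by (rule same_view_mono[OF x]) (use s in auto)
  then show "cl e = cl' e"
    unfolding cluster_def scale_of_local[OF x, symmetric] by (simp add: center_local)
qed

text \<open>With \<open>i\<close> the common scale, the way from \<open>u\<close> over
  \<open>Min e\<close>, the common center and \<open>Min e'\<close> to \<open>x\<close> takes at
  most 1 + 2i + 2i + 1 hops.\<close>

lemma cluster_radius:
  assumes "e \<in> E" "u \<in> e" "e' \<in> E" "x \<in> e'" "cl e = cl e'"
  shows "x \<in> ball_G E (4 * fst (cl e) + 2) u"
proof -
  let ?i = "fst (cl e)" and ?c = "snd (cl e)"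
  have "?c \<in> ball_G E (2 * ?i) (Min e)" by (simp add: cluster_def center_in_ball)
  then have 1: "?c \<in> ball_G E (1 + 2 * ?i) u"
    by (rule ball_trans[OF edge_in_ball[OF G assms(1,2) Min_edge[OF assms(1)]]])
  have "Min e' \<in> ball_G E (2 * ?i) ?c"
    unfolding assms(5) by (simp add: cluster_def ball_sym[of "Min e'"] center_in_ball)
  then have "Min e' \<in> ball_G E (1 + 2 * ?i + 2 * ?i) u" by (rule ball_trans[OF 1])
  then show ?thesis
    by (rule ball_trans') (use edge_in_ball[OF G assms(3) Min_edge[OF assms(3)] assms(4)] in auto)
qed

text \<open>By this symmetry an inclusion proved for one input yields an equality.\<close>

lemma swapped: "two_views n R V' E' V E"
  by unfold_locales (use G G' scales scales' in auto)

lemma clusters_at_local: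
  assumes "view (2 * R + 3) u"
  shows "clusters_at E cl i u = clusters_at E' cl' i u"
proof -
  have "{e \<in> E. u \<in> e} = {e \<in> E'. u \<in> e}"
    using cluster_local(1)[OF assms] two_views.cluster_local(1)[OF swapped same_view_sym[OF assms]]
    by blast
  moreover have "cl e = cl' e" if "e \<in> {e \<in> E. u \<in> e}" for e
    using cluster_local(2)[OF assms] that by simp
  ultimately have "cl ` {e \<in> E. u \<in> e} = cl' ` {e \<in> E'. u \<in> e}" by (metis (no_types, lifting) image_cong)
  then show ?thesis by (simp add: clusters_at_def)
qed

text \<open>All vertices of the cluster are within \<open>4 * fst g + 2\<close> hops of
  \<open>u\<close>, so the view of \<open>u\<close> contains the views of radius
  \<open>2 * R + 3\<close> that fix the clusters of their edges.\<close>

lemma members_local_sub: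
  assumes v: "view (2 * R + 3 + (4 * fst g + 2)) u" and g: "g \<in> clusters_at E cl (fst g) u"
  shows "members E cl g \<subseteq> members E' cl' g"
proof -
  have x: "view (2 * R + 3) x" if "e \<in> members E cl g" "x \<in> e" for e x
  proof -
    obtain e0 where "e0 \<in> E" "u \<in> e0" "cl e0 = g" using g by (auto simp: clusters_at_def)
    then have "x \<in> ball_G E (4 * fst g + 2) u"
      using cluster_radius[of e0 u e x] that by (auto simp: members_def)
    then show ?thesis by (rule same_view_sub[OF v]) simp
  qed
  show ?thesis
  proof
    fix e assume e: "e \<in> members E cl g"
    then have "e \<in> E" by (simp add: members_def)
    with cluster_local[OF x[OF e Min_edge] Min_edge] e
    show "e \<in> members E' cl' g" by (simp add: members_def)
  qed
qed

lemma members_local: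
  assumes v: "view (2 * R + 3 + (4 * fst g + 2)) u" and g: "g \<in> clusters_at E cl (fst g) u"
  shows "members E cl g = members E' cl' g"
proof
  have "view (2 * R + 3) u" by (rule same_view_mono[OF v]) simp
  then have "g \<in> clusters_at E' cl' (fst g) u" using g clusters_at_local by simp
  then show "members E' cl' g \<subseteq> members E cl g"
    by (rule two_views.members_local_sub[OF swapped same_view_sym[OF v]])
qed (rule members_local_sub[OF assms])

text \<open>Only the values of scale \<open>i\<close> are compared, because the iterations of
  different scales enlarge the radius by different amounts.\<close>

definition agree :: "nat \<Rightarrow> nat \<Rightarrow> state \<Rightarrow> state \<Rightarrow> bool" where
  "agree T i s s' \<longleftrightarrow> (\<forall>u. view T u \<longrightarrow>
     (\<forall>e\<in>E. u \<in> e \<longrightarrow> fst (cl e) = i \<longrightarrow> fst s e = fst s' e) \<and>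
     (\<forall>g. fst g = i \<longrightarrow> snd s u g = snd s' u g))"

lemma agreeD:
  assumes "agree T i s s'" "view T u"
  shows "e \<in> E \<Longrightarrow> u \<in> e \<Longrightarrow> fst (cl e) = i \<Longrightarrow> fst s e = fst s' e"
    and "fst g = i \<Longrightarrow> snd s u g = snd s' u g"
  using assms unfolding agree_def by blast+

lemma agree_mono: "agree T i s s' \<Longrightarrow> T \<le> T' \<Longrightarrow> agree T' i s s'"
  unfolding agree_def using same_view_mono by blast

text \<open>A vertex collects the edges and offers of its clusters of scale \<open>i\<close>, all
  within \<open>4 * i + 2\<close> hops, and evaluates the packing by itself; this is the added
  radius.\<close>

lemma agree_step:
  assumes r: "\<And>u. view T u \<Longrightarrow> r u = r' u" and T: "2 * R + 3 \<le> T" and s: "agree T i s s'"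
  shows "agree (T + (4 * i + 2)) i (step E cl R r s) (step E' cl' R r' s')"
  unfolding agree_def
proof (intro allI impI)
  fix u assume u: "view (T + (4 * i + 2)) u"
  have u0: "view (2 * R + 3) u" by (rule same_view_mono[OF u]) (use T in simp)
  have uT: "view T u" by (rule same_view_mono[OF u]) simp
  have mem: "members E cl g = members E' cl' g" and off: "offer E cl R r (snd s) g = offer E' cl' R r' (snd s') g"
    if g: "fst g = i" "g \<in> clusters_at E cl i u" for g
  proof -
    have "view (2 * R + 3 + (4 * fst g + 2)) u"
      by (rule same_view_mono[OF u]) (use T g in simp)
    then show mem: "members E cl g = members E' cl' g" using g by (intro members_local) auto
    show "offer E cl R r (snd s) g = offer E' cl' R r' (snd s') g"
    proof
      fix x
      show "offer E cl R r (snd s) g x = offer E' cl' R r' (snd s') g x"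
      proof (cases "g \<in> clusters_at E cl i x")
        case True
        then obtain e where e: "e \<in> E" "x \<in> e" "cl e = g" by (auto simp: clusters_at_def)
        obtain e0 where "e0 \<in> E" "u \<in> e0" "cl e0 = g" using g by (auto simp: clusters_at_def)
        then have "x \<in> ball_G E (4 * fst g + 2) u" using cluster_radius[of e0 u e x] e by auto
        then have x: "view T x" by (rule same_view_sub[OF u]) (use g in simp)
        then have "clusters_at E cl i x = clusters_at E' cl' i x"
          using T by (intro clusters_at_local same_view_mono[OF x])
        moreover have "snd s x h = snd s' x h" if "fst h = i" for h
          using agreeD(2)[OF s x that] .
        moreover from this have "pot E cl R (snd s) i x = pot E' cl' R (snd s') i x"
          unfolding pot_def calculation(1) by (intro sum.cong) (auto simp: clusters_at_def)
        ultimately show ?thesis using r[OF x] g by (simp add: offer_def)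
      next
        \<comment> \<open>Offers are functions on all vertices and must also agree where
          \<open>x\<close> meets no edge of the cluster. Equal edge sets make this the case in both
          graphs, and both offers are 0.\<close>
        case False
        then have "g \<notin> clusters_at E' cl' i x"
        proof (rule contrapos_nn)
          assume "g \<in> clusters_at E' cl' i x"
          then obtain e where "e \<in> members E' cl' g" "x \<in> e"
            by (auto simp: clusters_at_def members_def)
          then have "e \<in> E" "x \<in> e" "cl e = g" unfolding mem[symmetric] by (auto simp: members_def)
          then show "g \<in> clusters_at E cl i x" using g(1) by (auto simp: clusters_at_def)
        qed
        then show ?thesis using False g by (simp add: offer_def)
      qed
    qed
  qed
  then have bid: "bid E cl R r (snd s) g = bid E' cl' R r' (snd s') g"
    if "fst g = i" "g \<in> clusters_at E cl i u" for g
    using that by (simp add: bid_def)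
  show "(\<forall>e\<in>E. u \<in> e \<longrightarrow> fst (cl e) = i \<longrightarrow> fst (step E cl R r s) e = fst (step E' cl' R r' s') e) \<and>
     (\<forall>g. fst g = i \<longrightarrow> snd (step E cl R r s) u g = snd (step E' cl' R r' s') u g)"
  proof (intro conjI ballI allI impI)
    fix e assume e: "e \<in> E" "u \<in> e" "fst (cl e) = i"
    then have "cl e \<in> clusters_at E cl i u" by (auto simp: clusters_at_def)
    with e show "fst (step E cl R r s) e = fst (step E' cl' R r' s') e"
      using s uT cluster_local(2)[OF u0 e(2,1)] bid[of "cl e"] by (simp add: step_def agree_def)
  next
    fix g :: cluster assume g: "fst g = i"
    have "saturated E cl R r (snd s) u g \<longleftrightarrow> saturated E' cl' R r' (snd s') u g"
    proof (cases "g \<in> clusters_at E cl i u")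
      case True
      then show ?thesis
        using clusters_at_local[OF u0, of i] mem[OF g] off[OF g] bid[OF g] g by (simp add: saturated_def)
    next
      case False
      then show ?thesis using clusters_at_local[OF u0, of i] g by (simp add: saturated_def)
    qed
    then show "snd (step E cl R r s) u g = snd (step E' cl' R r' s') u g"
      using agreeD(2)[OF s uT g] by (simp add: step_def)
  qed
qed

lemma agree_steps:
  assumes r: "\<And>u. view T u \<Longrightarrow> r u = r' u" and T: "2 * R + 3 \<le> T" and s: "agree T i s s'"
  shows "agree (T + m * (4 * i + 2)) i ((step E cl R r ^^ m) s) ((step E' cl' R r' ^^ m) s')"
proof (induction m)
  case (Suc m)
  have "agree (T + m * (4 * i + 2) + (4 * i + 2)) i
      (step E cl R r ((step E cl R r ^^ m) s)) (step E' cl' R r' ((step E' cl' R r' ^^ m) s'))"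
    by (rule agree_step[OF _ _ Suc])
      (use T in \<open>auto intro!: r elim: same_view_mono\<close>)
  then show ?case by (simp add: algebra_simps)
qed (use s in simp)

lemma load_agree:
  assumes s: "\<And>i. agree T i s s'" and T: "2 * R + 3 \<le> T" and u: "view T u"
  shows "load E (fst s) u = load E' (fst s') u"
  unfolding load_def
proof (rule sum.cong)
  have u0: "view (2 * R + 3) u" by (rule same_view_mono[OF u T])
  show "{e. e \<in> E \<and> u \<in> e} = {e. e \<in> E' \<and> u \<in> e}"
    using cluster_local(1)[OF u0] two_views.cluster_local(1)[OF swapped same_view_sym[OF u0]] by auto
  fix e assume "e \<in> {e. e \<in> E' \<and> u \<in> e}"
  then show "fst s e = fst s' e"
    using s[of "fst (cl e)"] u two_views.cluster_local(1)[OF swapped same_view_sym[OF u0]]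
    by (simp add: agree_def)
qed

text \<open>The clustering needs radius \<open>2 * R + 3\<close>. An epoch adds
  \<open>(R div i) * (4 * i + 2)\<close>, at most \<open>6 * R\<close> for \<open>i \<ge> 1\<close>,
  and nothing for \<open>i = 0\<close> since \<open>R div 0 = 0\<close>.\<close>

lemma agree_epochs: "agree (2 * R + 3 + 6 * R * k) i (epochs E w cl R k) (epochs E' w' cl' R k)"
proof (induction k arbitrary: i)
  case (Suc k)
  let ?T = "2 * R + 3 + 6 * R * k"
  let ?s = "epochs E w cl R k" and ?s' = "epochs E' w' cl' R k"
  let ?r = "\<lambda>u. w u - load E (fst ?s) u" and ?r' = "\<lambda>u. w' u - load E' (fst ?s') u"
  let ?m = "R div i"
  have "agree (?T + ?m * (4 * i + 2)) i ((step E cl R ?r ^^ ?m) ?s) ((step E' cl' R ?r' ^^ ?m) ?s')"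
  proof (rule agree_steps[OF _ _ Suc])
    fix u assume u: "view ?T u"
    then have "w u = w' u" by (simp add: same_view_def)
    then show "?r u = ?r' u" using load_agree[OF Suc _ u] by simp
  qed simp
  moreover have "?m * (4 * i + 2) \<le> 6 * R"
  proof (cases "i = 0")
    case False
    then have "?m * (4 * i + 2) \<le> ?m * (6 * i)" by simp
    also have "\<dots> = 6 * (?m * i)" by simp
    also have "\<dots> \<le> 6 * R" by (intro mult_left_mono div_times_less_eq_dividend) simp
    finally show ?thesis .
  qed simp
  ultimately have *: "agree (2 * R + 3 + 6 * R * Suc k) i
      ((step E cl R ?r ^^ ?m) ?s) ((step E' cl' R ?r' ^^ ?m) ?s')"
    by (elim agree_mono) simp
  \<comment> \<open>The second input selects the run by its own cluster of \<open>e\<close>; as both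
    clusterings agree on \<open>e\<close>, this is also scale \<open>i\<close>.\<close>
  have "fst (epochs E' w' cl' R (Suc k)) e = fst ((step E' cl' R ?r' ^^ ?m) ?s') e"
    if "view (2 * R + 3 + 6 * R * Suc k) u" "e \<in> E" "u \<in> e" "fst (cl e) = i" for u e
  proof -
    have "view (2 * R + 3) u" by (rule same_view_mono[OF that(1)]) simp
    then have "cl' e = cl e" using cluster_local(2) that by simp
    then show ?thesis using that by (simp add: Let_def)
  qed
  with * show ?case unfolding agree_def by (simp add: Let_def)
qed (simp add: agree_def)

end

section \<open>The random clustering\<close>

lemma scale_exists:
  assumes G: "graph V E" "card V = n" "v \<in> V" and R: "1 \<le> R"
  shows "\<exists>i\<in>{1..R}. real (card (ball_G E (2 * i + 2) v)) \<le> growth n R i * real (card (ball_G E (2 * i) v))"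
proof (rule ccontr)
  let ?b = "\<lambda>i. real (card (ball_G E (2 * i) v))"
  assume "\<not> ?thesis"
  then have *: "growth n R i * ?b i < ?b (Suc i)" if "i \<in> {1..R}" for i
    using that by (auto simp: not_le)
  have fin: "finite V" using G by (simp add: graph_def)
  have n: "0 < n" using G fin card_gt_0_iff by auto
  \<comment> \<open>If every scale grew faster than allowed, the ball of radius
    \<open>2 * Suc m\<close> would have at least n to the power \<open>harm m / harm R\<close>
    vertices, since the exponents in \<open>growth\<close> add up to harmonic numbers over
    \<open>harm R\<close>.\<close>
  have step: "real n powr (harm (Suc m) / harm R) < ?b (Suc (Suc m))"
    if "real n powr (harm m / harm R) \<le> ?b (Suc m)" "Suc m \<le> R" for m
  proof -
    have "harm (Suc m) / harm R = harm m / harm R + 1 / (real (Suc m) * harm R)"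
      by (simp add: harm_Suc add_divide_distrib inverse_eq_divide)
    then have "real n powr (harm (Suc m) / harm R) = real n powr (harm m / harm R) * growth n R (Suc m)"
      by (simp only: growth_def powr_add)
    also have "\<dots> \<le> ?b (Suc m) * growth n R (Suc m)"
      using that by (intro mult_right_mono) (auto simp: growth_def)
    also have "\<dots> < ?b (Suc (Suc m))" using *[of "Suc m"] that by (simp add: mult.commute)
    finally show ?thesis .
  qed
  have "m < R \<Longrightarrow> real n powr (harm m / harm R) \<le> ?b (Suc m)" for m
  proof (induction m)
    case 0
    have "finite (ball_G E 2 v)" using ball_subset[OF G(1,3)] fin by (rule finite_subset)
    moreover have "v \<in> ball_G E 2 v" by simp
    ultimately have "0 < card (ball_G E 2 v)" unfolding card_gt_0_iff by blast
    then show ?case using n by (simp add: harm_def)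
  next
    case (Suc m)
    then show ?case using step[of m] by (simp add: less_imp_le)
  qed
  \<comment> \<open>The last scale is applied on its own to get a strict bound: more than
    \<open>n\<close> vertices.\<close>
  from step[OF this, of "R - 1"] have "real n powr (harm R / harm R) < ?b (Suc R)"
    using R by simp
  moreover have "harm R > (0::real)" using R by (intro harm_pos) simp
  moreover have "card (ball_G E (2 * Suc R) v) \<le> n"
    using card_mono[OF fin ball_subset[OF G(1,3)]] G(2) by blast
  ultimately show False using n by simp
qed

lemma scale_of:
  assumes "graph V E" "card V = n" "v \<in> V" "1 \<le> R"
  shows "scale_of n R E v \<in> {1..R}"
    and "real (card (ball_G E (2 * scale_of n R E v + 2) v))
      \<le> growth n R (scale_of n R E v) * real (card (ball_G E (2 * scale_of n R E v) v))"
proof -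
  let ?P = "\<lambda>i. i \<in> {1..R} \<and>
     real (card (ball_G E (2 * i + 2) v)) \<le> growth n R i * real (card (ball_G E (2 * i) v))"
  have "\<exists>i. ?P i" using scale_exists[OF assms] by blast
  then have "?P (Least ?P)" by (rule LeastI_ex)
  then show "scale_of n R E v \<in> {1..R}"
    and "real (card (ball_G E (2 * scale_of n R E v + 2) v))
      \<le> growth n R (scale_of n R E v) * real (card (ball_G E (2 * scale_of n R E v) v))"
    unfolding scale_of_def by blast+
qed

text \<open>Radius \<open>2 * i + 2\<close> covers the \<open>2 * i\<close>-balls of all vertices
  within two hops of \<open>v\<close>, such as other neighbours of a neighbour of
  \<open>v\<close>.\<close>

definition well_marked :: "nat \<Rightarrow> nat \<Rightarrow> (nat \<Rightarrow> real) \<Rightarrow> nat set \<Rightarrow> nat set set \<Rightarrow> (nat \<times> nat) set \<Rightarrow> bool" where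
  "well_marked n R \<kappa> V E M \<longleftrightarrow> (\<forall>v\<in>V. let i = scale_of n R E v; b = card (ball_G E (2 * i) v) in
     (\<exists>c\<in>ball_G E (2 * i) v. (c, b) \<in> M) \<and>
     real (card {c \<in> ball_G E (2 * i + 2) v. (c, b) \<in> M}) \<le> \<kappa> i)"

text \<open>The clusters of scale \<open>i\<close> at \<open>u\<close> come from the vertices
  \<open>Min e\<close> of its edges, which are within two hops of each other. Let \<open>v\<close>
  be one with the smallest \<open>2 * i\<close>-ball. The others chose centers marked for sizes at
  least that of \<open>v\<close>, hence by \<open>mono\<close> also marked for the size of
  \<open>v\<close>, and \<open>well_marked\<close> at \<open>v\<close> counts them all.\<close>

lemma card_clusters_at:
  assumes G: "graph V E" and M: "well_marked n R \<kappa> V E M" and \<kappa>: "0 \<le> \<kappa> i"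
    and mono: "\<And>c j k. (c, k) \<in> M \<Longrightarrow> 1 \<le> j \<Longrightarrow> j \<le> k \<Longrightarrow> (c, j) \<in> M"
  shows "real (card (clusters_at E (cluster n R E M) i u)) \<le> \<kappa> i"
proof (cases "clusters_at E (cluster n R E M) i u = {}")
  case False
  let ?cl = "cluster n R E M" and ?b = "\<lambda>v. card (ball_G E (2 * i) v)"
  define W where "W = Min ` {e \<in> E. u \<in> e \<and> fst (?cl e) = i}"
  have finV: "finite V" using G by (simp add: graph_def)
  have W: "v \<in> V \<and> scale_of n R E v = i \<and> v \<in> ball_G E 1 u \<and> u \<in> ball_G E 1 v" if v: "v \<in> W" for v
  proof -
    obtain e where e: "v = Min e" "e \<in> E" "u \<in> e" "fst (?cl e) = i" using v by (auto simp: W_def)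
    have "v \<in> e" unfolding e(1) using graph_edge[OF G e(2)] by (intro Min_in) auto
    then show ?thesis using e graph_edge(1)[OF G e(2)] edge_in_ball[OF G e(2)] by (auto simp: cluster_def)
  qed
  obtain g where "g \<in> clusters_at E ?cl i u" using False by blast
  then obtain e where "e \<in> E" "u \<in> e" "fst (?cl e) = i" by (auto simp: clusters_at_def)
  then have "finite W" "W \<noteq> {}"
    using graph_finite[OF G] by (auto simp: W_def)
  then have W_image: "finite (?b ` W)" "Min (?b ` W) \<in> ?b ` W" by (auto intro!: Min_in)
  then obtain v where v: "v \<in> W" and Min: "Min (?b ` W) = ?b v" by (elim imageE)
  have least: "?b v \<le> ?b x" if "x \<in> W" for x
    unfolding Min[symmetric] by (rule Min_le[OF W_image(1)]) (use that in blast)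
  have bv: "1 \<le> ?b v"
    using finite_subset[OF ball_subset[OF G] finV] W[OF v] ball_self[of v E "2 * i"]
    by (metis One_nat_def Suc_leI card_gt_0_iff empty_iff)
  let ?C = "{c \<in> ball_G E (2 * i + 2) v. (c, ?b v) \<in> M}"
  have "clusters_at E ?cl i u \<subseteq> Pair i ` ?C"
  proof
    fix g assume "g \<in> clusters_at E ?cl i u"
    then obtain e where e: "g = ?cl e" "e \<in> E" "u \<in> e" "fst (?cl e) = i" by (auto simp: clusters_at_def)
    define x where "x = Min e"
    have x: "x \<in> W" using e by (auto simp: W_def x_def)
    let ?D = "{c \<in> ball_G E (2 * i) x. (c, ?b x) \<in> M}"
    \<comment> \<open>By \<open>well_marked\<close> the default value of \<open>center\<close> does
      not occur here.\<close>
    have "\<exists>c. c \<in> ?D" using M W[OF x] by (auto simp: well_marked_def Let_def)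
    then have "(LEAST c. c \<in> ?D) \<in> ?D" by (rule LeastI_ex)
    moreover have "center E M i x = (LEAST c. c \<in> ?D)"
      using \<open>\<exists>c. c \<in> ?D\<close> by (auto simp: center_def Let_def)
    ultimately have c: "center E M i x \<in> ?D" by simp
    have "x \<in> ball_G E 2 v" by (rule ball_trans'[of u _ 1 _ _ 1]) (use W[OF v] W[OF x] in auto)
    then have "center E M i x \<in> ball_G E (2 * i + 2) v"
      by (rule ball_trans'[of x]) (use c in auto)
    then have "center E M i x \<in> ?C" using mono[OF _ bv least[OF x]] c by simp
    moreover have "g = (i, center E M i x)"
      using e(1) W[OF x] by (simp add: cluster_def x_def)
    ultimately show "g \<in> Pair i ` ?C" by blast
  qed
  moreover have "finite ?C" using finite_subset[OF ball_subset[OF G] finV] W[OF v] by auto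
  ultimately have "card (clusters_at E ?cl i u) \<le> card (Pair i ` ?C)" by (intro card_mono) auto
  also have "\<dots> \<le> card ?C" by (rule card_image_le) fact
  also have "real (card ?C) \<le> \<kappa> i" using M W[OF v] by (auto simp: well_marked_def Let_def)
  finally show ?thesis by simp
qed (use \<kappa> in simp)

section \<open>Tail bounds for independent uniform values\<close>

abbreviation unit_interval :: "real measure" where
  "unit_interval \<equiv> uniform_measure lborel {0..1}"

lemma prob_space_unit_interval: "prob_space unit_interval"
  by (rule prob_space_uniform_measure) auto

lemma prob_space_rand_space: "prob_space (rand_space V)"
  unfolding rand_space_def by (rule prob_space_PiM) (rule prob_space_unit_interval)

lemma measure_rand_space_all:
  assumes V: "finite V" "B \<subseteq> V" and S: "S \<in> sets borel"
  shows "{\<rho> \<in> space (rand_space V). \<forall>c\<in>B. \<rho> c \<in> S} \<in> sets (rand_space V)"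
    and "measure (rand_space V) {\<rho> \<in> space (rand_space V). \<forall>c\<in>B. \<rho> c \<in> S} =
      measure unit_interval S ^ card B"
proof -
  interpret U: prob_space unit_interval by (rule prob_space_unit_interval)
  interpret P: finite_product_prob_space "\<lambda>_. unit_interval" V
    by unfold_locales (use V in auto)
  let ?X = "\<lambda>c. if c \<in> B then S else UNIV"
  have eq: "{\<rho> \<in> space (rand_space V). \<forall>c\<in>B. \<rho> c \<in> S} = (\<Pi>\<^sub>E c\<in>V. ?X c)"
  proof (rule set_eqI)
    fix \<rho>
    have "(\<forall>c\<in>B. \<rho> c \<in> S) \<longleftrightarrow> (\<forall>c\<in>V. \<rho> c \<in> ?X c)" using V(2) by (simp add: Ball_def) blast
    then show "\<rho> \<in> {\<rho> \<in> space (rand_space V). \<forall>c\<in>B. \<rho> c \<in> S} \<longleftrightarrow> \<rho> \<in> (\<Pi>\<^sub>E c\<in>V. ?X c)"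
      by (simp add: rand_space_def space_PiM PiE_iff conj_commute)
  qed
  have X: "?X c \<in> sets unit_interval" for c using S by simp
  show "{\<rho> \<in> space (rand_space V). \<forall>c\<in>B. \<rho> c \<in> S} \<in> sets (rand_space V)"
    unfolding eq unfolding rand_space_def by (rule sets_PiM_I_finite) (use V X in auto)
  have "measure (rand_space V) (\<Pi>\<^sub>E c\<in>V. ?X c) = (\<Prod>c\<in>V. measure unit_interval (?X c))"
    unfolding rand_space_def by (rule P.prob_times) (rule X)
  also have "\<dots> = (\<Prod>c\<in>B. measure unit_interval S)"
    using V U.prob_space by (intro prod.mono_neutral_cong_right) auto
  finally show "measure (rand_space V) {\<rho> \<in> space (rand_space V). \<forall>c\<in>B. \<rho> c \<in> S} =
      measure unit_interval S ^ card B"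
    by (simp add: eq)
qed

lemma measure_unit_interval_le: "0 \<le> t \<Longrightarrow> measure unit_interval {..t} \<le> t"
proof -
  assume t: "0 \<le> t"
  have "measure unit_interval {..t} = measure lborel ({0..1} \<inter> {..t})"
    by (subst measure_uniform_measure) auto
  also have "{0..1} \<inter> {..t} = {0..min 1 t}" using t by auto
  also have "measure lborel {0..min 1 t} = min 1 t" using t by simp
  finally show ?thesis by simp
qed

lemma measure_unit_interval_gt: "0 \<le> t \<Longrightarrow> measure unit_interval {t<..} \<le> exp (- t)"
proof -
  assume t: "0 \<le> t"
  have "measure unit_interval {t<..} = measure lborel ({0..1} \<inter> {t<..})"
    by (subst measure_uniform_measure) auto
  also have "{0..1} \<inter> {t<..} = {t<..1}" using t by auto
  also have "measure lborel {t<..1} \<le> exp (- t)"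
    using exp_ge_add_one_self[of "- t"] by (cases "t \<le> 1") auto
  finally show ?thesis .
qed

lemma power_le_exp_fact: "real m ^ m \<le> exp (real m) * fact m"
proof -
  have "inverse (fact m) * real m ^ m \<le> (\<Sum>k. inverse (fact k) * real m ^ k)"
    using sum_le_suminf[OF summable_exp[of "real m"], of "{m}"] by simp
  also have "\<dots> = exp (real m)" by (simp add: exp_def scaleR_conv_of_real)
  finally show ?thesis by (simp add: field_simps)
qed

text \<open>The binomial coefficient is at most \<open>N^m / m!\<close>, and \<open>m!\<close> is at
  least \<open>(m / e)^m\<close>. As \<open>N * t\<close> is at most \<open>m / e^2\<close>, the
  m-th power of \<open>e / e^2\<close> remains.\<close>

lemma binomial_power_le:
  assumes "1 \<le> m" "0 \<le> t" "exp 2 * (real N * t) \<le> real m"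
  shows "real (N choose m) * t ^ m \<le> exp (- real m)"
proof -
  have "real (N choose m) * fact m \<le> real N ^ m"
    using binomial_fact_pow[of N m] by (metis of_nat_fact of_nat_le_iff of_nat_mult of_nat_power)
  then have "real (N choose m) \<le> real N ^ m / fact m" by (simp add: field_simps)
  then have "real (N choose m) * t ^ m \<le> real N ^ m / fact m * t ^ m"
    using assms by (intro mult_right_mono) auto
  also have "\<dots> = (real N * t) ^ m / fact m" by (simp add: power_mult_distrib)
  also have "\<dots> \<le> (real m * exp (- 2)) ^ m / fact m"
    using assms by (intro divide_right_mono power_mono) (auto simp: exp_minus field_simps)
  also have "\<dots> = real m ^ m / fact m * exp (- 2 * real m)"
    by (simp add: power_mult_distrib exp_of_nat_mult[symmetric] mult.commute)
  also have "\<dots> \<le> exp (real m) * exp (- 2 * real m)"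
    using power_le_exp_fact[of m] by (intro mult_right_mono) (auto simp: field_simps)
  also have "\<dots> = exp (- real m)" by (simp add: exp_add[symmetric])
  finally show ?thesis .
qed

lemma prob_no_hit:
  assumes "finite V" "B \<subseteq> V" "0 \<le> t"
  shows "{\<rho> \<in> space (rand_space V). \<forall>c\<in>B. t < \<rho> c} \<in> sets (rand_space V)"
    and "measure (rand_space V) {\<rho> \<in> space (rand_space V). \<forall>c\<in>B. t < \<rho> c} \<le> exp (- (t * real (card B)))"
proof -
  show "{\<rho> \<in> space (rand_space V). \<forall>c\<in>B. t < \<rho> c} \<in> sets (rand_space V)"
    using measure_rand_space_all(1)[OF assms(1,2), of "{t<..}"] by simp
  have "measure (rand_space V) {\<rho> \<in> space (rand_space V). \<forall>c\<in>B. t < \<rho> c}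
      = measure unit_interval {t<..} ^ card B"
    using measure_rand_space_all(2)[OF assms(1,2), of "{t<..}"] by simp
  also have "\<dots> \<le> exp (- t) ^ card B"
    by (intro power_mono measure_unit_interval_gt assms measure_nonneg)
  also have "\<dots> = exp (- (t * real (card B)))"
    by (simp add: exp_of_nat_mult[symmetric] mult.commute)
  finally show "measure (rand_space V) {\<rho> \<in> space (rand_space V). \<forall>c\<in>B. t < \<rho> c} \<le> exp (- (t * real (card B)))" .
qed

text \<open>Union bound: \<open>m\<close> hits contain a set of exactly \<open>m\<close> vertices
  that are all hit, which has probability at most \<open>t^m\<close> by independence.
  \<open>A\<close> is the union of these events.\<close>

lemma prob_many_hits:
  assumes V: "finite V" "B \<subseteq> V" and t: "0 \<le> t" and m: "1 \<le> m" "exp 2 * (real (card B) * t) \<le> real m"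
  obtains A where "A \<in> sets (rand_space V)" "measure (rand_space V) A \<le> exp (- real m)"
    "\<And>\<rho>. \<rho> \<in> space (rand_space V) \<Longrightarrow> m \<le> card {c \<in> B. \<rho> c \<le> t} \<Longrightarrow> \<rho> \<in> A"
proof
  interpret P: prob_space "rand_space V" by (rule prob_space_rand_space)
  have fB: "finite B" using V finite_subset by blast
  define S where "S = {X. X \<subseteq> B \<and> card X = m}"
  define F where "F X = {\<rho> \<in> space (rand_space V). \<forall>c\<in>X. \<rho> c \<le> t}" for X
  have S: "finite S" "card S = card B choose m"
    using fB n_subsets[OF fB, of m] by (auto simp: S_def)
  have F: "F X \<in> sets (rand_space V)" "measure (rand_space V) (F X) \<le> t ^ m" if "X \<in> S" for X
  proof -
    have X: "X \<subseteq> V" "card X = m" using that V by (auto simp: S_def)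
    show "F X \<in> sets (rand_space V)"
      using measure_rand_space_all(1)[OF V(1) X(1), of "{..t}"] by (simp add: F_def)
    have "measure (rand_space V) (F X) = measure unit_interval {..t} ^ m"
      using measure_rand_space_all(2)[OF V(1) X(1), of "{..t}"] X by (simp add: F_def)
    also have "\<dots> \<le> t ^ m" by (intro power_mono measure_unit_interval_le t measure_nonneg)
    finally show "measure (rand_space V) (F X) \<le> t ^ m" .
  qed
  show "(\<Union>X\<in>S. F X) \<in> sets (rand_space V)" using F S by (intro sets.finite_UN) auto
  have "measure (rand_space V) (\<Union>X\<in>S. F X) \<le> (\<Sum>X\<in>S. measure (rand_space V) (F X))"
    using F S by (intro P.finite_measure_subadditive_finite) auto
  also have "\<dots> \<le> (\<Sum>X\<in>S. t ^ m)" by (intro sum_mono F)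
  also have "\<dots> = real (card B choose m) * t ^ m" using S by simp
  also have "\<dots> \<le> exp (- real m)" by (rule binomial_power_le[OF m(1) t m(2)])
  finally show "measure (rand_space V) (\<Union>X\<in>S. F X) \<le> exp (- real m)" .
  fix \<rho> assume \<rho>: "\<rho> \<in> space (rand_space V)" and "m \<le> card {c \<in> B. \<rho> c \<le> t}"
  then obtain X where "X \<subseteq> {c \<in> B. \<rho> c \<le> t}" "card X = m" by (meson obtain_subset_with_card_n)
  then show "\<rho> \<in> (\<Union>X\<in>S. F X)" using \<rho> by (auto simp: S_def F_def)
qed

text \<open>One random value per vertex serves all sizes. A mark for \<open>k\<close> has
  probability at most \<open>4 * ln n / k\<close>, so a ball of \<open>k\<close> vertices expects at
  most \<open>4 * ln n\<close> of them. Sharing the value makes marks pass to smaller sizes, as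
  \<open>card_clusters_at\<close> requires.\<close>

definition marks :: "nat \<Rightarrow> nat set \<Rightarrow> (nat \<Rightarrow> real) \<Rightarrow> (nat \<times> nat) set" where
  "marks n V \<rho> = {(c, k). c \<in> V \<and> k \<in> {1..n} \<and> real k * \<rho> c \<le> 4 * ln (real n)}"

lemma marks_mono:
  assumes "(c, k) \<in> marks n V \<rho>" "1 \<le> j" "j \<le> k"
  shows "(c, j) \<in> marks n V \<rho>"
proof -
  have "real j * \<rho> c \<le> 4 * ln (real n)"
  proof (cases "0 \<le> \<rho> c")
    case True
    then have "real j * \<rho> c \<le> real k * \<rho> c" using assms by (intro mult_right_mono) auto
    then show ?thesis using assms by (auto simp: marks_def)
  next
    \<comment> \<open>Negative values have probability 0 but still occur as points of the
      space.\<close>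
    case False
    then have "real j * \<rho> c \<le> 0" by (simp add: mult_nonneg_nonpos)
    also have "0 \<le> 4 * ln (real n)" using assms by (auto simp: marks_def)
    finally show ?thesis .
  qed
  then show ?thesis using assms by (auto simp: marks_def)
qed

text \<open>\<open>marks n V\<close> takes finitely many values, each on a set given by finitely
  many threshold conditions, so any predicate \<open>Q\<close> is allowed.\<close>

lemma marks_measurable:
  assumes "finite V"
  shows "{\<rho> \<in> space (rand_space V). Q (marks n V \<rho>)} \<in> sets (rand_space V)"
proof -
  let ?D = "V \<times> {1..n}" and ?M = "rand_space V"
  have comp: "(\<lambda>\<rho>. \<rho> c) \<in> borel_measurable ?M" if "c \<in> V" for c
  proof -
    have "(\<lambda>\<rho>. \<rho> c) \<in> measurable ?M unit_interval"
      unfolding rand_space_def using that by (rule measurable_component_singleton)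
    moreover have "sets unit_interval = sets borel" by simp
    ultimately show ?thesis using measurable_cong_sets by blast
  qed
  have one: "{\<rho> \<in> space ?M. marks n V \<rho> = P} \<in> sets ?M" if "P \<subseteq> ?D" for P
  proof -
    have "{\<rho> \<in> space ?M. marks n V \<rho> = P} =
        {\<rho> \<in> space ?M. \<forall>x\<in>?D. (real (snd x) * \<rho> (fst x) \<le> 4 * ln (real n)) = (x \<in> P)}"
      using that by (auto simp: marks_def)
    also have "\<dots> \<in> sets ?M"
    proof (rule sets.sets_Collect_finite_All)
      fix x assume x: "x \<in> ?D"
      note [measurable] = comp[of "fst x"]
      have "fst x \<in> V" using x by auto
      then show "{\<rho> \<in> space ?M. (real (snd x) * \<rho> (fst x) \<le> 4 * ln (real n)) = (x \<in> P)} \<in> sets ?M"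
        by measurable
    qed (use assms in auto)
    finally show ?thesis .
  qed
  have "{\<rho> \<in> space ?M. Q (marks n V \<rho>)} = (\<Union>P\<in>{P \<in> Pow ?D. Q P}. {\<rho> \<in> space ?M. marks n V \<rho> = P})"
    by (auto simp: marks_def)
  also have "\<dots> \<in> sets ?M"
    using assms one by (intro sets.finite_UN) auto
  finally show ?thesis .
qed

text \<open>By the choice of the scale, the larger ball expects at most
  \<open>growth n R i * (4 * ln n)\<close> marks. The factor \<open>exp 2\<close> is the slack
  needed in \<open>binomial_power_le\<close>, and 1 absorbs rounding up.\<close>

definition cluster_bound :: "nat \<Rightarrow> nat \<Rightarrow> nat \<Rightarrow> real" where
  "cluster_bound n R i = exp 2 * (growth n R i * (4 * ln (real n))) + 1"

text \<open>Union bound over the vertices: a smaller ball without a center and a larger ball with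
  too many each have probability at most \<open>n^-4\<close>, and the total \<open>2 / n^3\<close>
  is at most \<open>1 / n\<close>.\<close>

lemma prob_well_marked:
  assumes G: "graph V E" "card V = n" and n: "2 \<le> n" and R: "1 \<le> R"
  shows "1 - 1 / real n
    \<le> measure (rand_space V) {\<rho> \<in> space (rand_space V). well_marked n R (cluster_bound n R) V E (marks n V \<rho>)}"
proof -
  let ?M = "rand_space V"
  interpret P: prob_space ?M by (rule prob_space_rand_space)
  have V: "finite V" using G by (simp add: graph_def)
  define i where "i v = scale_of n R E v" for v
  define B where "B v = ball_G E (2 * i v) v" for v
  define B' where "B' v = ball_G E (2 * i v + 2) v" for v
  define t where "t v = 4 * ln (real n) / real (card (B v))" for v
  define \<kappa> where "\<kappa> v = cluster_bound n R (i v)" for v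
  define m where "m v = nat \<lceil>exp 2 * (growth n R (i v) * (4 * ln (real n)))\<rceil>" for v
  have ln: "0 < ln (real n)" using n by simp
  have Bsub: "B v \<subseteq> V" "B' v \<subseteq> V" and i: "i v \<in> {1..R}"
    and grow: "real (card (B' v)) \<le> growth n R (i v) * real (card (B v))"
    and cB: "card (B v) \<in> {1..n}" if v: "v \<in> V" for v
  proof -
    show s: "B v \<subseteq> V" "B' v \<subseteq> V" unfolding B_def B'_def using ball_subset[OF G(1) v] by auto
    show "i v \<in> {1..R}" "real (card (B' v)) \<le> growth n R (i v) * real (card (B v))"
      unfolding i_def B_def B'_def using scale_of[OF G v R] by auto
    have "v \<in> B v" by (simp add: B_def)
    then have "card (B v) \<noteq> 0" using finite_subset[OF s(1) V] by auto
    then show "card (B v) \<in> {1..n}" using card_mono[OF V s(1)] G by simp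
  qed
  have g1: "1 \<le> growth n R (i v)" for v
    unfolding growth_def using n harm_nonneg[of R, where 'a=real] by (intro ge_one_powr_ge_zero) auto
  have four: "exp (- (4 * ln (real n))) = 1 / real n ^ 4"
    using exp_of_nat_mult[of 4 "ln (real n)"] n by (simp add: exp_minus inverse_eq_divide)
  have t: "0 \<le> t v" for v using ln by (simp add: t_def)
  have mm: "exp 2 * (real (card (B' v)) * t v) \<le> real (m v)" "1 \<le> m v" "4 * ln (real n) \<le> real (m v)"
     if v: "v \<in> V" for v
  proof -
    have "real (card (B' v)) * t v \<le> growth n R (i v) * real (card (B v)) * t v"
      by (rule mult_right_mono[OF grow[OF v] t])
    also have "\<dots> = growth n R (i v) * (4 * ln (real n))" using cB[OF v] by (simp add: t_def)
    finally have "exp 2 * (real (card (B' v)) * t v) \<le> exp 2 * (growth n R (i v) * (4 * ln (real n)))"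
      by simp
    also have "\<dots> \<le> real (m v)" unfolding m_def by linarith
    finally show "exp 2 * (real (card (B' v)) * t v) \<le> real (m v)" .
    \<comment> \<open>As \<open>growth\<close> is at least 1, so is the ratio of \<open>m v\<close>
      to \<open>4 * ln n\<close>, and the tail \<open>exp (- m v)\<close> is at most
      \<open>n^-4\<close>.\<close>
    have "1 \<le> exp (2::real)" by simp
    then have "1 * (1 * (4 * ln (real n))) \<le> exp 2 * (growth n R (i v) * (4 * ln (real n)))"
      using g1[of v] ln by (intro mult_mono) auto
    also have "\<dots> \<le> real (m v)" unfolding m_def by linarith
    finally show *: "4 * ln (real n) \<le> real (m v)" by simp
    then show "1 \<le> m v" using ln by linarith
  qed
  have "\<forall>v\<in>V. \<exists>A. A \<in> sets ?M \<and> measure ?M A \<le> exp (- real (m v)) \<and>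
      (\<forall>\<rho>\<in>space ?M. m v \<le> card {c \<in> B' v. \<rho> c \<le> t v} \<longrightarrow> \<rho> \<in> A)"
  proof
    fix v assume v: "v \<in> V"
    show "\<exists>A. A \<in> sets ?M \<and> measure ?M A \<le> exp (- real (m v)) \<and>
      (\<forall>\<rho>\<in>space ?M. m v \<le> card {c \<in> B' v. \<rho> c \<le> t v} \<longrightarrow> \<rho> \<in> A)"
      by (rule prob_many_hits[OF V Bsub(2)[OF v] t mm(2,1)[OF v]]) blast
  qed
  from bchoice[OF this] obtain A where A: "\<And>v. v \<in> V \<Longrightarrow> A v \<in> sets ?M"
    "\<And>v. v \<in> V \<Longrightarrow> measure ?M (A v) \<le> exp (- real (m v))"
    "\<And>v \<rho>. v \<in> V \<Longrightarrow> \<rho> \<in> space ?M \<Longrightarrow> m v \<le> card {c \<in> B' v. \<rho> c \<le> t v} \<Longrightarrow> \<rho> \<in> A v"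
    by blast
  define N where "N v = {\<rho> \<in> space ?M. \<forall>c\<in>B v. t v < \<rho> c}" for v
  have N: "N v \<in> sets ?M" "measure ?M (N v) \<le> exp (- (4 * ln (real n)))" if v: "v \<in> V" for v
    using prob_no_hit[OF V Bsub(1)[OF v] t, of v] cB[OF v] by (auto simp: N_def t_def)
  let ?W = "{\<rho> \<in> space ?M. well_marked n R (cluster_bound n R) V E (marks n V \<rho>)}"
  let ?bad = "\<Union>v\<in>V. N v \<union> A v"
  have bad: "?bad \<in> sets ?M" using N A V by (intro sets.finite_UN) auto
  have "measure ?M ?bad \<le> (\<Sum>v\<in>V. measure ?M (N v \<union> A v))"
    using N A V by (intro P.finite_measure_subadditive_finite) auto
  also have "\<dots> \<le> (\<Sum>v\<in>V. 2 / real n ^ 4)"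
  proof (rule sum_mono)
    fix v assume v: "v \<in> V"
    have "measure ?M (N v \<union> A v) \<le> measure ?M (N v) + measure ?M (A v)"
      using N A v by (intro measure_subadditive) (auto simp: P.emeasure_eq_measure)
    also have "\<dots> \<le> exp (- (4 * ln (real n))) + exp (- (4 * ln (real n)))"
      using N(2)[OF v] A(2)[OF v] mm(3)[OF v] by (intro add_mono) (auto elim: order_trans)
    finally show "measure ?M (N v \<union> A v) \<le> 2 / real n ^ 4" by (simp add: four)
  qed
  also have "\<dots> = 2 / real n ^ 3" using G n by (simp add: power_def numeral_eq_Suc)
  also have "\<dots> \<le> 1 / real n"
  proof -
    have "2 * 1 \<le> real n * real n" using n by (intro mult_mono) auto
    then show ?thesis using n by (simp add: field_simps power3_eq_cube)
  qed
  finally have "1 - 1 / real n \<le> measure ?M (space ?M - ?bad)"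
    using P.prob_compl[OF bad] by simp
  also have "\<dots> \<le> measure ?M ?W"
  proof (rule P.finite_measure_mono)
    show "space ?M - ?bad \<subseteq> ?W"
    proof
      fix \<rho> assume \<rho>: "\<rho> \<in> space ?M - ?bad"
      have mark: "(c, card (B v)) \<in> marks n V \<rho> \<longleftrightarrow> \<rho> c \<le> t v" if "v \<in> V" "c \<in> V" for c v
        using cB[OF that(1)] that by (auto simp: marks_def t_def field_simps)
      have "(\<exists>c\<in>B v. (c, card (B v)) \<in> marks n V \<rho>) \<and>
          real (card {c \<in> B' v. (c, card (B v)) \<in> marks n V \<rho>}) \<le> \<kappa> v" if v: "v \<in> V" for v
      proof
        have "\<rho> \<notin> N v" using \<rho> v by auto
        then obtain c where "c \<in> B v" "\<rho> c \<le> t v" using \<rho> by (auto simp: N_def not_less)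
        then show "\<exists>c\<in>B v. (c, card (B v)) \<in> marks n V \<rho>"
          using mark[OF v, of c] Bsub(1)[OF v] by blast
        have "{c \<in> B' v. (c, card (B v)) \<in> marks n V \<rho>} = {c \<in> B' v. \<rho> c \<le> t v}"
          using mark[OF v] Bsub(2)[OF v] by blast
        moreover have "card {c \<in> B' v. \<rho> c \<le> t v} < m v"
          using A(3)[OF v, of \<rho>] \<rho> v by force
        moreover have "real (m v) \<le> \<kappa> v"
        proof -
          have "0 \<le> growth n R (i v)" using g1[of v] by linarith
          then have "0 \<le> exp 2 * (growth n R (i v) * (4 * ln (real n)))" using ln by simp
          then show ?thesis unfolding m_def \<kappa>_def cluster_bound_def by linarith
        qed
        ultimately show "real (card {c \<in> B' v. (c, card (B v)) \<in> marks n V \<rho>}) \<le> \<kappa> v" by simp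
      qed
      then show "\<rho> \<in> ?W"
        using \<rho> by (simp add: well_marked_def Let_def B_def B'_def i_def \<kappa>_def)
    qed
    show "?W \<in> sets ?M" by (rule marks_measurable[OF V])
  qed
  finally show ?thesis .
qed

section \<open>The algorithm\<close>

text \<open>The exponent 1/8 makes \<open>R^4\<close>, the factor of
  \<open>ln (4 / \<epsilon>)\<close> in \<open>num_epochs\<close>, of order
  \<open>(ln n) powr (1/2)\<close>, while \<open>harm R\<close> and \<open>ln R\<close> keep the
  order of \<open>ln (ln n)\<close>.\<close>

definition num_scales :: "nat \<Rightarrow> nat" where
  "num_scales n = Suc (nat \<lfloor>ln (real n) powr (1/8)\<rfloor>)"

text \<open>The sum multiplied by 4 bounds \<open>i * (ln K + R^3 * ln (4 / \<epsilon>))\<close> for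
  every scale \<open>i\<close>, with \<open>K\<close> the cluster bound. The 4 is 2 for the two
  endpoints of an edge times 2 for rounding down in \<open>R div i\<close>; \<open>Suc\<close> makes
  the comparison in \<open>enough_epochs\<close> strict.\<close>

definition num_epochs :: "nat \<Rightarrow> real \<Rightarrow> nat" where
  "num_epochs n \<epsilon> = (let R = num_scales n; l = ln (real n) in
     Suc (nat \<lceil>4 * (l / harm R + real R * (4 + ln (4 * l + 1)) + real R ^ 4 * ln (4 / \<epsilon>))
                  / (real R * ln (real (Suc R)))\<rceil>))"

definition rounds :: "nat \<Rightarrow> real \<Rightarrow> nat" where
  "rounds n \<epsilon> = 2 * num_scales n + 3 + 6 * num_scales n * num_epochs n \<epsilon>"

definition edge_packing ::
    "nat \<Rightarrow> real \<Rightarrow> nat set set \<Rightarrow> (nat \<Rightarrow> real) \<Rightarrow> (nat \<times> nat) set \<Rightarrow> nat set \<Rightarrow> real" where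
  "edge_packing n \<epsilon> E w M =
     fst (epochs E w (cluster n (num_scales n) E M) (num_scales n) (num_epochs n \<epsilon>))"

definition cover_alg :: "nat \<Rightarrow> real \<Rightarrow> dist_alg" where
  "cover_alg n \<epsilon> V E w \<rho> v \<longleftrightarrow>
     (1 - \<epsilon> / 4) * w v \<le> load E (edge_packing n \<epsilon> E w (marks n V \<rho>)) v"

lemma num_scales_pos: "1 \<le> num_scales n"
  by (simp add: num_scales_def)

lemma local_cover_alg: "local_alg (rounds n \<epsilon>) n (cover_alg n \<epsilon>)"
  unfolding local_alg_def
proof (intro allI impI, elim conjE)
  fix V E w V' E' w' and \<rho> \<rho>' :: "nat \<Rightarrow> real" and v
  let ?T = "rounds n \<epsilon>" and ?R = "num_scales n"
  assume vi: "valid_input n V E w" "valid_input n V' E' w'" and v: "v \<in> V" "v \<in> V'"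
    and ball: "ball_G E ?T v = ball_G E' ?T v"
    and inp: "\<forall>u\<in>ball_G E ?T v. w u = w' u \<and> \<rho> u = \<rho>' u"
    and edges: "\<forall>x\<in>ball_G E ?T v. \<forall>y\<in>ball_G E ?T v. ({x, y} \<in> E) = ({x, y} \<in> E')"
  have graphs: "graph V E" "card V = n" "graph V' E'" "card V' = n" using vi by (auto simp: valid_input_def)
  interpret two_views n ?R V E w "marks n V \<rho>" V' E' w' "marks n V' \<rho>'"
    using graphs scale_of(1)[OF _ _ _ num_scales_pos] by unfold_locales auto
  \<comment> \<open>\<open>marks\<close> depends on the vertex set, but the common ball lies in both
    \<open>V\<close> and \<open>V'\<close>.\<close>
  have "(u, k) \<in> marks n V \<rho> \<longleftrightarrow> (u, k) \<in> marks n V' \<rho>'" if u: "u \<in> ball_G E ?T v" for u k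
  proof -
    have "u \<in> V" using ball_subset[OF graphs(1) v(1)] u by blast
    moreover have "u \<in> V'" using ball_subset[OF graphs(3) v(2)] u ball by blast
    ultimately show ?thesis using inp u by (simp add: marks_def)
  qed
  then have view: "view ?T v" using ball inp edges by (simp add: same_view_def)
  have "load E (edge_packing n \<epsilon> E w (marks n V \<rho>)) v = load E' (edge_packing n \<epsilon> E' w' (marks n V' \<rho>')) v"
    unfolding edge_packing_def
    by (rule load_agree[OF agree_epochs]) (use view in \<open>simp_all add: rounds_def\<close>)
  moreover have "w v = w' v" using inp by simp
  ultimately show "cover_alg n \<epsilon> V E w \<rho> v = cover_alg n \<epsilon> V' E' w' \<rho>' v"
    by (simp add: cover_alg_def)
qed

section \<open>Sufficiency of the epochs, and the approximation guarantee\<close>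

lemma enough_epochs:
  assumes n: "2 \<le> n" and \<epsilon>: "0 < \<epsilon>" "\<epsilon> < 1" and i: "i \<in> {1..num_scales n}"
  shows "(cluster_bound n (num_scales n) i * (1 / (\<epsilon> / 4)) ^ (num_scales n ^ 3)) ^ 2
    < real (Suc (num_scales n)) ^ (num_epochs n \<epsilon> * (num_scales n div i))"
proof -
  define R where "R = num_scales n"
  define l where "l = ln (real n)"
  define A where "A = l / harm R + real R * (4 + ln (4 * l + 1)) + real R ^ 4 * ln (4 / \<epsilon>)"
  define K where "K = cluster_bound n R i"
  have R: "1 \<le> R" and i: "1 \<le> i" "i \<le> R" using num_scales_pos i by (auto simp: R_def)
  have l: "0 < l" using n by (simp add: l_def)
  have H: "0 < (harm R :: real)" using R by (intro harm_pos) simp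
  have g: "growth n R i = exp (l / (real i * harm R))"
    using n by (simp add: growth_def powr_def l_def)
  have lng: "0 \<le> l / (real i * harm R)"
    using l less_imp_le[OF H] by (intro divide_nonneg_nonneg mult_nonneg_nonneg) auto
  have "K \<le> exp 4 * (4 * l + 1) * growth n R i"
  proof -
    have "1 \<le> growth n R i" unfolding g using lng by simp
    moreover have "1 \<le> exp (4::real)" by simp
    ultimately have "1 * 1 \<le> exp 4 * growth n R i" by (intro mult_mono) auto
    moreover have "exp 2 * (growth n R i * (4 * l)) \<le> exp 4 * (growth n R i * (4 * l))"
      using l g by (intro mult_right_mono) auto
    ultimately show ?thesis by (simp add: K_def cluster_bound_def l_def algebra_simps)
  qed
  also have "\<dots> = exp (4 + ln (4 * l + 1) + l / (real i * harm R))"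
    using l by (simp add: exp_add g)
  finally have K: "K \<le> exp (4 + ln (4 * l + 1) + l / (real i * harm R))" .
  have K1: "1 \<le> K" using l by (simp add: K_def cluster_bound_def l_def[symmetric] g)
  then have lnK: "ln K \<le> 4 + ln (4 * l + 1) + l / (real i * harm R)"
    using K ln_mono[of K] by fastforce
  have l4: "0 < ln (4 * l + 1)" "0 < ln (4 / \<epsilon>)" using l \<epsilon> by auto
  have lnR: "0 < ln (real (Suc R))" using R by simp
  \<comment> \<open>Multiplying by \<open>i\<close> cancels the \<open>i\<close> in the exponent of
    \<open>growth\<close>, so the main term \<open>l / harm R\<close> is the same for all scales;
    elsewhere \<open>i\<close> is bounded by \<open>R\<close>.\<close>
  have "real i * (ln K + real (R ^ 3) * ln (4 / \<epsilon>)) \<le> A"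
  proof -
    have "real i * ln K \<le> real i * (4 + ln (4 * l + 1) + l / (real i * harm R))"
      using lnK by (rule mult_left_mono) simp
    also have "\<dots> = real i * (4 + ln (4 * l + 1)) + l / harm R" using i by (simp add: field_simps)
    also have "\<dots> \<le> real R * (4 + ln (4 * l + 1)) + l / harm R"
      using i l4 by (intro add_right_mono mult_right_mono) auto
    finally have "real i * ln K \<le> real R * (4 + ln (4 * l + 1)) + l / harm R" .
    moreover have "real i * (real (R ^ 3) * ln (4 / \<epsilon>)) \<le> real R * (real (R ^ 3) * ln (4 / \<epsilon>))"
      using i l4 by (intro mult_right_mono mult_nonneg_nonneg) auto
    moreover have "real R * (real (R ^ 3) * ln (4 / \<epsilon>)) = real R ^ 4 * ln (4 / \<epsilon>)"
      by (simp add: power4_eq_xxxx power3_eq_cube)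
    ultimately show ?thesis unfolding A_def distrib_left by linarith
  qed
  moreover have "A * 4 < real (num_epochs n \<epsilon>) * (real R * ln (real (Suc R)))"
  proof -
    have "4 * A / (real R * ln (real (Suc R))) < real (num_epochs n \<epsilon>)"
      unfolding num_epochs_def Let_def R_def[symmetric] l_def[symmetric] A_def[symmetric] by linarith
    then show ?thesis using R lnR by (simp add: pos_divide_less_eq mult.commute)
  qed
  moreover have "real R * real (num_epochs n \<epsilon>) * ln (real (Suc R))
      \<le> 2 * (real i * (real (num_epochs n \<epsilon> * (R div i)) * ln (real (Suc R))))"
  proof -
    \<comment> \<open>As \<open>R div i\<close> is at least 1, rounding down loses less than a
      factor 2.\<close>
    have "R < i * (R div i) + i" using i by (metis Suc_le_lessD add.commute mult.commute
        dividend_less_div_times One_nat_def)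
    moreover have "i \<le> i * (R div i)" using i by (simp add: Suc_leI div_greater_zero_iff)
    ultimately have "R \<le> 2 * (i * (R div i))" by linarith
    then have "real R \<le> 2 * (real i * real (R div i))" by (metis of_nat_le_iff of_nat_mult of_nat_numeral)
    then have "real R * (real (num_epochs n \<epsilon>) * ln (real (Suc R)))
        \<le> 2 * (real i * real (R div i)) * (real (num_epochs n \<epsilon>) * ln (real (Suc R)))"
      using lnR by (intro mult_right_mono mult_nonneg_nonneg) auto
    then show ?thesis by (simp add: algebra_simps)
  qed
  ultimately have "real i * (2 * (ln K + real (R ^ 3) * ln (4 / \<epsilon>)))
      < real i * (real (num_epochs n \<epsilon> * (R div i)) * ln (real (Suc R)))"
    by (simp add: algebra_simps)
  then have "2 * (ln K + real (R ^ 3) * ln (4 / \<epsilon>))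
      < real (num_epochs n \<epsilon> * (R div i)) * ln (real (Suc R))"
    using i by simp
  then have "exp (2 * (ln K + real (R ^ 3) * ln (4 / \<epsilon>)))
      < exp (real (num_epochs n \<epsilon> * (R div i)) * ln (real (Suc R)))"
    by simp
  moreover have "exp (2 * (ln K + real (R ^ 3) * ln (4 / \<epsilon>))) = (K * (1 / (\<epsilon> / 4)) ^ (R ^ 3)) ^ 2"
  proof -
    have "exp (2 * (ln K + real (R ^ 3) * ln (4 / \<epsilon>))) = exp (ln K + real (R ^ 3) * ln (4 / \<epsilon>)) ^ 2"
      by (rule exp_double)
    also have "exp (real (R ^ 3) * ln (4 / \<epsilon>)) = (4 / \<epsilon>) ^ (R ^ 3)"
      unfolding exp_of_nat_mult using \<epsilon> by simp
    then have "exp (ln K + real (R ^ 3) * ln (4 / \<epsilon>)) = K * (1 / (\<epsilon> / 4)) ^ (R ^ 3)"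
      using K1 by (simp add: exp_add)
    finally show ?thesis .
  qed
  moreover have "exp (real (num_epochs n \<epsilon> * (R div i)) * ln (real (Suc R)))
      = real (Suc R) ^ (num_epochs n \<epsilon> * (R div i))"
    unfolding exp_of_nat_mult by simp
  ultimately have "(K * (1 / (\<epsilon> / 4)) ^ (R ^ 3)) ^ 2 < real (Suc R) ^ (num_epochs n \<epsilon> * (R div i))"
    by (simp only:)
  then show ?thesis by (simp only: K_def R_def)
qed

text \<open>Given good marks nothing random remains. \<open>edge_covered\<close> with
  \<open>\<delta> = \<epsilon> / 4\<close> puts an endpoint of each edge in the output. Chosen
  vertices have nearly their weight as load, all loads sum to twice the matching, and duality bounds
  the matching by the optimum.\<close>

lemma cover_alg_correct:
  assumes vi: "valid_input n V E w" and n: "2 \<le> n" and \<epsilon>: "0 < \<epsilon>" "\<epsilon> < 1"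
    and M: "well_marked n (num_scales n) (cluster_bound n (num_scales n)) V E (marks n V \<rho>)"
  shows "is_vertex_cover V E (alg_output (cover_alg n \<epsilon>) V E w \<rho>)"
    and "sum w (alg_output (cover_alg n \<epsilon>) V E w \<rho>) \<le> (2 + \<epsilon>) * OPT_vc V E w"
proof -
  define R where "R = num_scales n"
  define cl where "cl = cluster n R E (marks n V \<rho>)"
  define y where "y = edge_packing n \<epsilon> E w (marks n V \<rho>)"
  define S where "S = alg_output (cover_alg n \<epsilon>) V E w \<rho>"
  have G: "graph V E" "card V = n" and w: "\<And>v. v \<in> V \<Longrightarrow> 0 \<le> w v" using vi by (auto simp: valid_input_def)
  have V: "finite V" and E: "finite E" using graph_finite[OF G(1)] by auto
  have sub: "\<Union>E \<subseteq> V" using graph_edge(1)[OF G(1)] by blast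
  have scale: "fst (cl e) \<in> {1..R}" if e: "e \<in> E" for e
  proof -
    have "Min e \<in> e" using graph_edge[OF G(1) e] by (intro Min_in)
    then have "Min e \<in> V" using sub e by blast
    then show ?thesis using scale_of(1)[OF G _ num_scales_pos] by (simp add: cl_def cluster_def R_def)
  qed
  interpret clustered_graph E cl R
    by unfold_locales (use E graph_edge[OF G(1)] scale in auto)
  have y: "y = fst (epochs E w cl R (num_epochs n \<epsilon>))"
    by (simp add: y_def edge_packing_def cl_def R_def)
  have wE: "0 \<le> w u" if "u \<in> \<Union>E" for u using w sub that by blast
  have S: "S = {v \<in> V. (1 - \<epsilon> / 4) * w v \<le> load E y v}"
    by (simp add: S_def alg_output_def cover_alg_def y_def)
  have \<kappa>: "real (card (clusters_at E cl i u)) \<le> cluster_bound n R i" for i u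
    unfolding cl_def
  proof (rule card_clusters_at[OF G(1)])
    show "well_marked n R (cluster_bound n R) V E (marks n V \<rho>)" using M by (simp add: R_def)
    show "0 \<le> cluster_bound n R i"
      using n by (simp add: cluster_bound_def growth_def add_nonneg_nonneg)
  qed (rule marks_mono)
  have "e \<inter> S \<noteq> {}" if e: "e \<in> E" for e
  proof -
    have "\<exists>u\<in>e. (1 - \<epsilon> / 4) * w u \<le> load E y u"
      unfolding y
    proof (rule edge_covered[OF wE e graph_edge(2)[OF G(1) e] _ \<kappa>])
      show "(cluster_bound n R (fst (cl e)) * (1 / (\<epsilon> / 4)) ^ R ^ 3)\<^sup>2
          < real (Suc R) ^ (num_epochs n \<epsilon> * (R div fst (cl e)))"
        using enough_epochs[OF n \<epsilon>] scale[OF e] by (simp only: R_def)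
    qed (use \<epsilon> in auto)
    then show ?thesis using S graph_edge(1)[OF G(1) e] by blast
  qed
  then show "is_vertex_cover V E (alg_output (cover_alg n \<epsilon>) V E w \<rho>)"
    unfolding S_def[symmetric] by (auto simp: is_vertex_cover_def S)
  let ?costs = "{sum w S | S. is_vertex_cover V E S}"
  have "?costs \<subseteq> sum w ` Pow V" by (auto simp: is_vertex_cover_def)
  then have "finite ?costs" using V finite_subset by blast
  moreover have "is_vertex_cover V E V"
    using graph_edge[OF G(1)] by (auto simp: is_vertex_cover_def Int_absorb2)
  ultimately have "OPT_vc V E w \<in> ?costs" unfolding OPT_vc_def by (intro Min_in) auto
  then obtain S0 where S0: "is_vertex_cover V E S0" "OPT_vc V E w = sum w S0" by auto
  have y0: "0 \<le> y e" for e unfolding y by (rule Y_nonneg[OF wE])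
  have load_le: "load E y u \<le> w u" if u: "u \<in> V" for u
  proof (cases "u \<in> \<Union>E")
    case True
    then show ?thesis using residual_nonneg[OF wE True, where k = "num_epochs n \<epsilon>"] by (simp add: residual_def y)
  next
    case False
    then have "{e. e \<in> E \<and> u \<in> e} = {}" by auto
    then show ?thesis using w[OF u] by (simp only: load_def sum.empty)
  qed
  have dual: "sum y E \<le> OPT_vc V E w"
    unfolding S0(2) by (rule packing_le_cover[OF E y0 S0(1) V load_le])
  then have OPT: "0 \<le> OPT_vc V E w" using sum_nonneg[of E y] y0 by simp
  have "(1 - \<epsilon> / 4) * sum w S = (\<Sum>v\<in>S. (1 - \<epsilon> / 4) * w v)" by (rule sum_distrib_left)
  also have "\<dots> \<le> (\<Sum>v\<in>S. load E y v)" by (rule sum_mono) (simp add: S)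
  also have "\<dots> \<le> (\<Sum>v\<in>V. load E y v)"
    by (rule sum_mono2) (use V y0 in \<open>auto simp: S intro: load_nonneg\<close>)
  also have "\<dots> = 2 * sum y E"
    by (rule sum_load[OF E V]) (use graph_edge[OF G(1)] in auto)
  also have "\<dots> \<le> 2 * OPT_vc V E w" using dual by simp
  also have "\<dots> \<le> (1 - \<epsilon> / 4) * ((2 + \<epsilon>) * OPT_vc V E w)"
  proof -
    \<comment> \<open>The product below is \<open>2 + \<epsilon> / 2 - \<epsilon>^2 / 4\<close>;
      this is where the threshold \<open>1 - \<epsilon> / 4\<close> fits the ratio.\<close>
    have "\<epsilon> * \<epsilon> \<le> \<epsilon> * 1" using \<epsilon> by (intro mult_left_mono) auto
    then have "2 \<le> (1 - \<epsilon> / 4) * (2 + \<epsilon>)" using \<epsilon> by (simp add: algebra_simps)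
    then show ?thesis using OPT unfolding mult.assoc[symmetric] by (rule mult_right_mono)
  qed
  finally have "sum w S \<le> (2 + \<epsilon>) * OPT_vc V E w"
    using \<epsilon> by (subst (asm) mult_le_cancel_left_pos) auto
  then show "sum w (alg_output (cover_alg n \<epsilon>) V E w \<rho>) \<le> (2 + \<epsilon>) * OPT_vc V E w"
    by (simp add: S_def)
qed

lemma prob_cover_alg:
  assumes vi: "valid_input n V E w" and n: "1 \<le> n" and \<epsilon>: "0 < \<epsilon>" "\<epsilon> < 1"
  shows "1 - real n powr (- 1) \<le> measure (rand_space V)
     {\<rho> \<in> space (rand_space V).
        is_vertex_cover V E (alg_output (cover_alg n \<epsilon>) V E w \<rho>) \<and>
        sum w (alg_output (cover_alg n \<epsilon>) V E w \<rho>) \<le> (2 + \<epsilon>) * OPT_vc V E w}"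
    (is "_ \<le> measure ?M {\<rho> \<in> _. ?ok \<rho>}")
\<comment> \<open>For \<open>n = 1\<close> the required probability is 0.\<close>
proof (cases "n = 1")
  case False
  interpret P: prob_space ?M by (rule prob_space_rand_space)
  have n2: "2 \<le> n" and G: "graph V E" "card V = n" "finite V"
    using False n vi by (auto simp: valid_input_def graph_def)
  let ?W = "{\<rho> \<in> space ?M.
     well_marked n (num_scales n) (cluster_bound n (num_scales n)) V E (marks n V \<rho>)}"
  have "1 - real n powr (- 1) = 1 - 1 / real n" using n by (simp add: powr_minus_divide)
  also have "\<dots> \<le> measure ?M ?W" by (rule prob_well_marked[OF G(1,2) n2 num_scales_pos])
  also have "\<dots> \<le> measure ?M {\<rho> \<in> space ?M. ?ok \<rho>}"
  proof (rule P.finite_measure_mono)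
    show "?W \<subseteq> {\<rho> \<in> space ?M. ?ok \<rho>}" using cover_alg_correct[OF vi n2 \<epsilon>] by blast
    \<comment> \<open>Written as a predicate of the marks alone, success is measurable by
      \<open>marks_measurable\<close>.\<close>
    let ?out = "\<lambda>M. {v \<in> V. (1 - \<epsilon> / 4) * w v \<le> load E (edge_packing n \<epsilon> E w M) v}"
    let ?Q = "\<lambda>M. is_vertex_cover V E (?out M) \<and> sum w (?out M) \<le> (2 + \<epsilon>) * OPT_vc V E w"
    have "{\<rho> \<in> space ?M. ?Q (marks n V \<rho>)} \<in> sets ?M" by (rule marks_measurable[OF G(3)])
    then show "{\<rho> \<in> space ?M. ?ok \<rho>} \<in> sets ?M" by (simp add: alg_output_def cover_alg_def)
  qed
  finally show ?thesis .
qed simp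

section \<open>Asymptotic number of rounds\<close>

lemma rounds_bound:
  "\<exists>C N0. \<forall>n\<ge>N0. \<forall>\<epsilon>. 0 < \<epsilon> \<and> \<epsilon> < 1 \<longrightarrow>
     real (rounds n \<epsilon>) \<le> C * (ln (real n) / (ln (ln (real n)))^2
                          + ln (real n) * ln (1 / \<epsilon>) / (ln (ln (real n)))^3)"
proof -
  \<comment> \<open>\<open>?A\<close> collects the terms without \<open>ln (1 / \<epsilon>)\<close>,
    and 3072 = 192 * 16 belongs to the coefficient of \<open>ln (1 / \<epsilon>)\<close>, so
    \<open>N0\<close> does not depend on \<open>\<epsilon>\<close>. The leading coefficient of
    \<open>?A\<close> is 192 * 8 = 1536, below 2000.\<close>
  let ?A = "\<lambda>l::real. 28 * l powr (1/8) + 3 +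
     192 / ln l * (8 * (l / ln l) + 2 * l powr (1/8) * (4 + ln (4 * l + 1)) + 16 * l powr (1/2) * ln 4)"
  have "\<forall>\<^sub>F l in at_top. ?A l \<le> 2000 * (l / (ln l)^2) \<and>
      3072 * l powr (1/2) / ln l \<le> 2000 * (l / (ln l)^3) \<and> exp 1 \<le> l"
    by (intro eventually_conj) (real_asymp, real_asymp, rule eventually_ge_at_top)
  moreover have "filterlim (\<lambda>n. ln (real n)) at_top sequentially" by real_asymp
  ultimately have "\<forall>\<^sub>F n in sequentially. ?A (ln (real n)) \<le> 2000 * (ln (real n) / (ln (ln (real n)))^2) \<and>
      3072 * ln (real n) powr (1/2) / ln (ln (real n)) \<le> 2000 * (ln (real n) / (ln (ln (real n)))^3) \<and>
      exp 1 \<le> ln (real n)"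
    by (rule eventually_compose_filterlim)
  then obtain N0 where N0: "\<And>n. N0 \<le> n \<Longrightarrow> ?A (ln (real n)) \<le> 2000 * (ln (real n) / (ln (ln (real n)))^2) \<and>
      3072 * ln (real n) powr (1/2) / ln (ln (real n)) \<le> 2000 * (ln (real n) / (ln (ln (real n)))^3) \<and>
      exp 1 \<le> ln (real n)"
    by (auto simp: eventually_sequentially)
  have "real (rounds n \<epsilon>) \<le> 2000 * (ln (real n) / (ln (ln (real n)))^2
      + ln (real n) * ln (1 / \<epsilon>) / (ln (ln (real n)))^3)"
    if n: "N0 \<le> n" and \<epsilon>: "0 < \<epsilon>" "\<epsilon> < 1" for n \<epsilon>
  proof -
    define l where "l = ln (real n)"
    define L where "L = ln (1 / \<epsilon>)"
    define R where "R = num_scales n"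
    define X where "X = l / harm R + real R * (4 + ln (4 * l + 1)) + real R ^ 4 * ln (4 / \<epsilon>)"
    note N = N0[OF n, folded l_def]
    have "1 + 1 \<le> exp (1::real)" by (rule exp_ge_add_one_self)
    then have l: "2 \<le> l" using N by linarith
    have lnl: "1 \<le> ln l" using N l by (subst ln_ge_iff) auto
    have L: "0 \<le> L" "ln (4 / \<epsilon>) = ln 4 + L" using \<epsilon> by (auto simp: L_def ln_div)
    have p: "1 \<le> l powr (1/8)" using l by (intro ge_one_powr_ge_zero) auto
    have R1: "1 \<le> real R" using num_scales_pos[of n] by (simp add: R_def)
    have R: "l powr (1/8) \<le> real R" "real R \<le> 2 * l powr (1/8)"
      using p unfolding R_def num_scales_def l_def[symmetric] by linarith+
    \<comment> \<open>Both gains are of order \<open>ln l\<close>: the logarithm of the potential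
      base \<open>Suc R\<close>, and \<open>harm R\<close>.\<close>
    have "ln l / 8 = ln (l powr (1/8))" using l by (simp add: ln_powr)
    also have "\<dots> \<le> ln (real (Suc R))" by (rule ln_mono) (use p R in auto)
    finally have lnR: "ln l / 8 \<le> ln (real (Suc R))" .
    also have "ln (real (Suc R)) \<le> harm R" using ln_le_harm[of R] by (simp add: add.commute)
    finally have harm: "ln l / 8 \<le> harm R" .
    have X: "X \<le> 8 * (l / ln l) + 2 * l powr (1/8) * (4 + ln (4 * l + 1)) + 16 * l powr (1/2) * (ln 4 + L)"
    proof -
      have 1: "l / harm R \<le> 8 * (l / ln l)"
      proof -
        have "l / harm R \<le> l / (ln l / 8)"
          using harm lnl l R1 by (intro divide_left_mono mult_pos_pos) auto
        then show ?thesis by (simp add: mult.commute)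
      qed
      have 2: "real R * (4 + ln (4 * l + 1)) \<le> 2 * l powr (1/8) * (4 + ln (4 * l + 1))"
        using R l by (intro mult_right_mono) auto
      have 3: "real R ^ 4 * (ln 4 + L) \<le> 16 * l powr (1/2) * (ln 4 + L)"
      proof (rule mult_right_mono)
        have "real R ^ 4 \<le> (2 * l powr (1/8)) ^ 4" using R R1 by (intro power_mono) auto
        also have "\<dots> = 16 * l powr (1/2)"
          using l by (simp add: power_mult_distrib powr_power)
        finally show "real R ^ 4 \<le> 16 * l powr (1/2)" .
      qed (use L in auto)
      show ?thesis unfolding X_def L(2) by (intro add_mono 1 2 3)
    qed
    have "0 \<le> l / harm R + real R * (4 + ln (4 * l + 1)) + real R ^ 4 * (ln 4 + L)"
      using l lnl harm L by (intro add_nonneg_nonneg mult_nonneg_nonneg divide_nonneg_nonneg) auto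
    then have X0: "0 \<le> X" by (simp add: X_def L(2))
    have "real (num_epochs n \<epsilon>) \<le> 4 * X / (real R * ln (real (Suc R))) + 2"
      unfolding num_epochs_def Let_def R_def[symmetric] l_def[symmetric] X_def[symmetric]
    proof -
      have "0 \<le> 4 * X / (real R * ln (real (Suc R)))"
        using X0 R1 by (intro divide_nonneg_nonneg mult_nonneg_nonneg) auto
      then show "real (Suc (nat \<lceil>4 * X / (real R * ln (real (Suc R)))\<rceil>))
          \<le> 4 * X / (real R * ln (real (Suc R))) + 2"
        by linarith
    qed
    then have "6 * real R * real (num_epochs n \<epsilon>) \<le> 6 * real R * (4 * X / (real R * ln (real (Suc R))) + 2)"
      by (rule mult_left_mono) simp
    also have "\<dots> = 24 * X / ln (real (Suc R)) + 12 * real R" using R1 by (simp add: field_simps)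
    \<comment> \<open>Of the 14, 2 comes from the clustering radius and 12 from the two extra epochs
      due to rounding.\<close>
    finally have "real (rounds n \<epsilon>) \<le> 14 * real R + 3 + 24 * X / ln (real (Suc R))"
      by (simp add: rounds_def R_def)
    also have "24 * X / ln (real (Suc R)) \<le> 24 * X / (ln l / 8)"
    proof (rule divide_left_mono[OF lnR])
      have "0 < ln (real (Suc R))" using lnR lnl by linarith
      then show "0 < ln (real (Suc R)) * (ln l / 8)" using lnl by (intro mult_pos_pos) auto
    qed (use X0 in simp)
    also have "\<dots> = 192 / ln l * X" by simp
    also have "\<dots> \<le> 192 / ln l *
        (8 * (l / ln l) + 2 * l powr (1/8) * (4 + ln (4 * l + 1)) + 16 * l powr (1/2) * (ln 4 + L))"
      using lnl by (intro mult_left_mono X) auto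
    also have "14 * real R + 3 + \<dots> \<le> ?A l + 3072 * l powr (1/2) / ln l * L"
      using R by (simp add: algebra_simps)
    also have "\<dots> \<le> 2000 * (l / (ln l)^2) + 2000 * (l / (ln l)^3) * L"
      using N L by (intro add_mono mult_right_mono) auto
    also have "\<dots> = 2000 * (l / (ln l)^2 + l * L / (ln l)^3)" by (simp add: algebra_simps)
    finally show ?thesis by (simp add: l_def L_def)
  qed
  then show ?thesis by blast
qed

theorem theorem2:
  shows "\<exists>(A :: nat \<Rightarrow> real \<Rightarrow> dist_alg) (T :: nat \<Rightarrow> real \<Rightarrow> nat).
     (\<forall>n \<epsilon>. 0 < \<epsilon> \<and> \<epsilon> < 1 \<longrightarrow> local_alg (T n \<epsilon>) n (A n \<epsilon>)) \<and>
     (\<exists>C N0. \<forall>n \<ge> N0. \<forall>\<epsilon>. 0 < \<epsilon> \<and> \<epsilon> < 1 \<longrightarrow>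
        real (T n \<epsilon>) \<le> C * (ln (real n) / (ln (ln (real n)))^2
                           + ln (real n) * ln (1 / \<epsilon>) / (ln (ln (real n)))^3)) \<and>
     (\<exists>c::real. c \<ge> 1 \<and>
        (\<forall>n \<ge> 1. \<forall>\<epsilon> V E w. 0 < \<epsilon> \<and> \<epsilon> < 1 \<and> valid_input n V E w \<longrightarrow>
           measure (rand_space V)
             {\<rho> \<in> space (rand_space V).
                is_vertex_cover V E (alg_output (A n \<epsilon>) V E w \<rho>) \<and>
                sum w (alg_output (A n \<epsilon>) V E w \<rho>) \<le> (2 + \<epsilon>) * OPT_vc V E w}
           \<ge> 1 - real n powr (- c)))"
proof (intro exI[of _ cover_alg] exI[of _ rounds] conjI)
  show "\<exists>c::real. c \<ge> 1 \<and>
        (\<forall>n \<ge> 1. \<forall>\<epsilon> V E w. 0 < \<epsilon> \<and> \<epsilon> < 1 \<and> valid_input n V E w \<longrightarrow>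
           measure (rand_space V)
             {\<rho> \<in> space (rand_space V).
                is_vertex_cover V E (alg_output (cover_alg n \<epsilon>) V E w \<rho>) \<and>
                sum w (alg_output (cover_alg n \<epsilon>) V E w \<rho>) \<le> (2 + \<epsilon>) * OPT_vc V E w}
           \<ge> 1 - real n powr (- c))"
    using prob_cover_alg by (intro exI[of _ "1::real"]) blast
qed (use local_cover_alg rounds_bound in blast)+

end
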